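(* Suppose assumptions A1–A6 (listed in the context) hold. Let $p^*$ be the optimal value of the mean-type measure program and $d^*$ the optimal value of the mean-type function program (both defined in the context). Then strong duality between the two programs holds, $p^*=d^*$, with attainment of optimality.
   Context: Setting. $T>0$ is a finite time horizon and $h\in(0,T]$ a window length. $X\subset\mathbb{R}^n$ is the state set, $X_0\subseteq X$ the initial set, $p:X\to\mathbb{R}$ a state function. A stochastic process on $X$ is given as a family of laws $\{\mu_t\}$ with $t\in[0,T]$ (continuous time) or $t\in\{k\Delta t\}_{k=0}^{T/\Delta t}$ (discrete time), and is uniquely described by its generator $\mathcal{L}$ with domain $\mathcal{C}$. Writing $t'=t+\Delta t'$, $\mathcal{L}_{\Delta t}v(t,x)=\lim_{\Delta t'\to\Delta t}\frac{\langle v(t',x),\mu_{t'}\rangle-\langle v(t,x),\mu_t\rangle}{\Delta t'}$; in discrete time $\mathcal{L}=\mathcal{L}_{\Delta t}$ (e.g. for $x[t+\Delta t]=f(t,x[t],\lambda[t])$, $\lambda[t]\sim\zeta$: $\mathcal{L}v(t,x)=(\mathbb{E}_\zeta[v(t+\Delta t,f(t,x,\lambda))]-v(t,x))/\Delta t$, $\mathcal{C}=C([0,T]\times X)$), and in continuous time $\mathcal{L}=\lim_{\Delta t\to0}\mathcal{L}_{\Delta t}$ (e.g. for an Itô SDE $dx=f\,dt+g\,dW$: $\mathcal{L}v=\partial_tv+f\cdot\nabla_xv+\frac12g^T(\nabla^2_{xx}v)g$, $\mathcal{C}=C^{1,2}([0,T]\times X)$). The exit time is $\tau_X=\inf\{t: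 x(t)\in\partial X\}$. Assumptions. A1: $X_0$, $X$, $[0,T]$ are compact. A2: $p$ is continuous. A3: trajectories stop according to the rule $\min(T,\tau_X)$. A4: $\mathcal{C}=\mathrm{dom}(\mathcal{L})\subseteq C([0,T]\times X)$, $1\in\mathcal{C}$, $\mathcal{L}1=0$. A5: $\mathcal{C}$ is closed under multiplication and separates points of $[0,T]\times X$. A6: there is a countable set $\{v_k\}\subset\mathcal{C}$ such that for every $v\in\mathcal{C}$, $(v,\mathcal{L}v)$ lies in the bounded pointwise closure of $\mathrm{span}\{(v_k,\mathcal{L}v_k)\}$. Augmented dynamics. $\hat{\mathcal{L}}$ is the generator of the process $(s,x(t))$ in which $s$ is constant and $x(t)$ follows $\mathcal{L}$; for test functions $v(s,t,x)$, $\hat{\mathcal{L}}v$ is obtained by applying $\mathcal{L}$ in $(t,x)$ with $s$ as a parameter. $\mathcal{C}([h,T]\times[0,T]\times X)$ denotes the domain of $\hat{\mathcal{L}}$ (continuous $v$ with $v(s,\cdot,\cdot)\in\mathcal{C}$ for each $s$ and $\hat{\mathcal L}v$ continuous). Temporal supports: $\Omega_+=\{(s,t)\in[h,T]\times[0,T]: t\in[s-h,s]\}$; $\Omega_-=\{(s,t)\in[h,T]\times[0,T]:t\in[0,s-h]\}$ in continuous time, and $\Omega_-=\{(s,t)\in[h,T]\times[0,T]:t\in[0,s-h-\Delta t]\}$ in discrete time. $\varphi:(s,x)\mapsto(s,s,x)$. $\mathcal{M}_+(K)$ is the set of nonnegative Radon measures on $K$; $\langle f,\mu\rangle=\int f\,d\mu$;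 $\varphi_\#$ is pushforward; $\hat{\mathcal{L}}^\dagger$ is the adjoint of $\hat{\mathcal{L}}$. Mean-type measure program. $p^*=\sup\langle p,\mu_+\rangle/h$ over $\mu_0\in\mathcal{M}_+([h,T]\times X_0)$, $\mu_\tau\in\mathcal{M}_+([h,T]\times X)$ (both in variables $(s,x)$), $\mu_+\in\mathcal{M}_+(\Omega_+\times X)$, $\mu_-\in\mathcal{M}_+(\Omega_-\times X)$ (in variables $(s,t,x)$), subject to $\varphi_\#\mu_\tau=\delta_0\otimes\mu_0+\hat{\mathcal{L}}^\dagger(\mu_-+\mu_+)$, $\langle1,\mu_0\rangle=1$, $\langle1,\mu_+\rangle=h$. The first constraint means that for all $v\in\mathcal{C}([h,T]\times[0,T]\times X)$: $\langle v(s,s,x),\mu_\tau\rangle=\langle v(s,0,x),\mu_0\rangle+\langle\hat{\mathcal{L}}v,\mu_-+\mu_+\rangle$. Mean-type function program. $d^*=\inf\ \gamma+h\xi$ over $v\in\mathcal{C}([h,T]\times[0,T]\times X)$ and $\gamma,\xi\in\mathbb{R}$ subject to: $\gamma\ge v(s,0,x)$ for all $(s,x)\in[h,T]\times X_0$; $v(s,s,x)\ge0$ for all $(s,x)\in[h,T]\times X$; $\hat{\mathcal{L}}v(s,t,x)+p(x)/h\le\xi$ for all $(s,t,x)\in\Omega_+\times X$; $\hat{\mathcal{L}}v(s,t,x)\le0$ for all $(s,t,x)\in\Omega_-\times X$.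
   Formalization: Attainment is proved for the measure program only, and only if it has a feasible point (it may be infeasible, and attainment in the function program can fail); that the function t lies in the domain with Lt=1 is made an explicit assumption. *)

theory Defs
  imports "HOL-Probability.Probability"
begin

datatype time_model = Continuous_Time | Discrete_Time real

fun valid_time :: "time_model \<Rightarrow> real \<Rightarrow> bool" where
  "valid_time Continuous_Time T \<longleftrightarrow> True"
| "valid_time (Discrete_Time dt) T \<longleftrightarrow> 0 < dt \<and> (\<exists>N::nat. T = real N * dt)"

fun times_from :: "time_model \<Rightarrow> real \<Rightarrow> real \<Rightarrow> real set" where
  "times_from Continuous_Time T t = {t..T}"
| "times_from (Discrete_Time dt) T t = {t + real k * dt | k::nat. t + real k * dt \<le> T}"

text \<open>The stopping time \<open>min(T, \<tau>\<^sub>X)\<close> of a trajectory \<open>y\<close> that starts at time \<open>t\<close>,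
  where \<open>\<tau>\<^sub>X\<close> is the first time in \<open>\<partial>X\<close> (\<open>T\<close> if the trajectory never reaches \<open>\<partial>X\<close>).\<close>

definition stop_time ::
    "time_model \<Rightarrow> real \<Rightarrow> 'a::topological_space set \<Rightarrow> real \<Rightarrow> (real \<Rightarrow> 'a) \<Rightarrow> real" where
  "stop_time tm T X t y = Inf (insert T {t' \<in> times_from tm T t. y t' \<in> frontier X})"

text \<open>A stochastic process on \<open>X\<close>: \<open>Y t' \<omega>\<close> is the state at time \<open>t'\<close>, and \<open>P t x\<close> is the
  probability law under which the process is at \<open>x\<close> at time \<open>t\<close>. Trajectories are frozen
  once they have stopped.\<close>

definition stopped_process ::
    "time_model \<Rightarrow> real \<Rightarrow> 'a::euclidean_space set \<Rightarrow> (real \<Rightarrow> 'a \<Rightarrow> 'w measure) \<Rightarrow>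
     (real \<Rightarrow> 'w \<Rightarrow> 'a) \<Rightarrow> bool" where
  "stopped_process tm T X P Y \<longleftrightarrow>
     (\<forall>t\<in>{0..T}. \<forall>x\<in>X.
        prob_space (P t x) \<and>
        (\<forall>t'\<in>times_from tm T t. Y t' \<in> borel_measurable (P t x) \<and> (AE \<omega> in P t x. Y t' \<omega> \<in> X)) \<and>
        (AE \<omega> in P t x. Y t \<omega> = x) \<and>
        (AE \<omega> in P t x. \<forall>t'\<in>times_from tm T t.
           stop_time tm T X t (\<lambda>u. Y u \<omega>) \<le> t' \<longrightarrow>
           Y t' \<omega> = Y (stop_time tm T X t (\<lambda>u. Y u \<omega>)) \<omega>))"

definition mean_quotient ::
    "(real \<Rightarrow> 'a \<Rightarrow> 'w measure) \<Rightarrow> (real \<Rightarrow> 'w \<Rightarrow> 'a) \<Rightarrow> (real \<times> 'a \<Rightarrow> real) \<Rightarrow>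
     real \<Rightarrow> 'a \<Rightarrow> real \<Rightarrow> real" where
  "mean_quotient P Y v t x t' =
     ((\<integral>\<omega>. v (t', Y t' \<omega>) \<partial>P t x) - v (t, x)) / (t' - t)"

fun generates_at ::
    "time_model \<Rightarrow> real \<Rightarrow> (real \<Rightarrow> 'a \<Rightarrow> 'w measure) \<Rightarrow> (real \<Rightarrow> 'w \<Rightarrow> 'a) \<Rightarrow>
     (real \<times> 'a \<Rightarrow> real) \<Rightarrow> (real \<times> 'a \<Rightarrow> real) \<Rightarrow> real \<Rightarrow> 'a \<Rightarrow> bool" where
  "generates_at Continuous_Time T P Y v w t x \<longleftrightarrow>
     (t < T \<longrightarrow> (mean_quotient P Y v t x \<longlongrightarrow> w (t, x)) (at_right t))"
| "generates_at (Discrete_Time dt) T P Y v w t x \<longleftrightarrow>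
     (t + dt \<le> T \<longrightarrow> w (t, x) = mean_quotient P Y v t x (t + dt))"

text \<open>Functions on \<open>D\<close> are represented by total functions, so the domain \<open>C\<close> and the operator
  \<open>L\<close> must not depend on values outside \<open>D\<close>.\<close>

definition linear_operator_on ::
    "'d set \<Rightarrow> ('d \<Rightarrow> real) set \<Rightarrow> (('d \<Rightarrow> real) \<Rightarrow> 'd \<Rightarrow> real) \<Rightarrow> bool" where
  "linear_operator_on D C L \<longleftrightarrow>
     (\<forall>v\<in>C. \<forall>w. (\<forall>z\<in>D. w z = v z) \<longrightarrow> w \<in> C \<and> (\<forall>z\<in>D. L w z = L v z)) \<and>
     (\<forall>v\<in>C. \<forall>w\<in>C. \<forall>a b. (\<lambda>z. a * v z + b * w z) \<in> C \<and>
        (\<forall>z\<in>D. L (\<lambda>z. a * v z + b * w z) z = a * L v z + b * L w z))"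

text \<open>\<open>L\<close> with domain \<open>C\<close> is the generator of the process \<open>(P, Y)\<close>. On \<open>\<partial>X\<close> trajectories
  are already stopped, so the difference quotients of the stopped process determine \<open>L v\<close> only
  for \<open>x\<close> in the interior of \<open>X\<close>. The difference quotients of the time coordinate
  are identically 1, so it belongs to the domain, with image 1 (also at \<open>\<partial>X\<close> and at \<open>t = T\<close>).\<close>

definition is_generator ::
    "time_model \<Rightarrow> real \<Rightarrow> 'a::euclidean_space set \<Rightarrow> (real \<Rightarrow> 'a \<Rightarrow> 'w measure) \<Rightarrow>
     (real \<Rightarrow> 'w \<Rightarrow> 'a) \<Rightarrow> (real \<times> 'a \<Rightarrow> real) set \<Rightarrow>
     ((real \<times> 'a \<Rightarrow> real) \<Rightarrow> real \<times> 'a \<Rightarrow> real) \<Rightarrow> bool" where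
  "is_generator tm T X P Y C L \<longleftrightarrow>
     linear_operator_on ({0..T} \<times> X) C L \<and>
     (\<forall>v\<in>C. \<forall>t\<in>{0..T}. \<forall>x\<in>interior X. generates_at tm T P Y v (L v) t x) \<and>
     (\<lambda>(t, x). t) \<in> C \<and> (\<forall>z\<in>{0..T} \<times> X. L (\<lambda>(t, x). t) z = 1)"

definition separates_points :: "('d \<Rightarrow> real) set \<Rightarrow> 'd set \<Rightarrow> bool" where
  "separates_points C D \<longleftrightarrow> (\<forall>y\<in>D. \<forall>z\<in>D. y \<noteq> z \<longrightarrow> (\<exists>v\<in>C. v y \<noteq> v z))"

text \<open>Bounded pointwise closure on \<open>D\<close> of a set of pairs of functions: the smallest superset
  closed under pointwise limits of uniformly bounded sequences.\<close>

inductive_set bp_closure ::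
    "'d set \<Rightarrow> (('d \<Rightarrow> real) \<times> ('d \<Rightarrow> real)) set \<Rightarrow> (('d \<Rightarrow> real) \<times> ('d \<Rightarrow> real)) set"
  for D :: "'d set" and S :: "(('d \<Rightarrow> real) \<times> ('d \<Rightarrow> real)) set" where
  base: "q \<in> S \<Longrightarrow> q \<in> bp_closure D S"
| limit: "(\<And>n::nat. (f n, g n) \<in> bp_closure D S) \<Longrightarrow>
    (\<And>n z. z \<in> D \<Longrightarrow> \<bar>f n z\<bar> \<le> B \<and> \<bar>g n z\<bar> \<le> B) \<Longrightarrow>
    (\<And>z. z \<in> D \<Longrightarrow> (\<lambda>n. f n z) \<longlonglongrightarrow> f' z) \<Longrightarrow>
    (\<And>z. z \<in> D \<Longrightarrow> (\<lambda>n. g n z) \<longlonglongrightarrow> g' z) \<Longrightarrow>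
    (f', g') \<in> bp_closure D S"

definition graph_span ::
    "(('d \<Rightarrow> real) \<Rightarrow> 'd \<Rightarrow> real) \<Rightarrow> ('d \<Rightarrow> real) set \<Rightarrow> (('d \<Rightarrow> real) \<times> ('d \<Rightarrow> real)) set" where
  "graph_span L V =
     {(\<lambda>z. \<Sum>v\<in>F. c v * v z, \<lambda>z. \<Sum>v\<in>F. c v * L v z) | F c. finite F \<and> F \<subseteq> V}"

text \<open>Compactness of \<open>[0,T]\<close> is automatic.\<close>

definition assumption_A1 :: "'a::euclidean_space set \<Rightarrow> 'a set \<Rightarrow> bool" where
  "assumption_A1 X X0 \<longleftrightarrow> compact X0 \<and> compact X"

definition assumption_A2 :: "'a::euclidean_space set \<Rightarrow> ('a \<Rightarrow> real) \<Rightarrow> bool" where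
  "assumption_A2 X p \<longleftrightarrow> continuous_on X p"

definition assumption_A3 ::
    "time_model \<Rightarrow> real \<Rightarrow> 'a::euclidean_space set \<Rightarrow> (real \<Rightarrow> 'a \<Rightarrow> 'w measure) \<Rightarrow>
     (real \<Rightarrow> 'w \<Rightarrow> 'a) \<Rightarrow> bool" where
  "assumption_A3 tm T X P Y \<longleftrightarrow> stopped_process tm T X P Y"

definition assumption_A4 ::
    "real \<Rightarrow> 'a::euclidean_space set \<Rightarrow> (real \<times> 'a \<Rightarrow> real) set \<Rightarrow>
     ((real \<times> 'a \<Rightarrow> real) \<Rightarrow> real \<times> 'a \<Rightarrow> real) \<Rightarrow> bool" where
  "assumption_A4 T X C L \<longleftrightarrow>
     (\<forall>v\<in>C. continuous_on ({0..T} \<times> X) v) \<and>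
     (\<lambda>_. 1) \<in> C \<and> (\<forall>z\<in>{0..T} \<times> X. L (\<lambda>_. 1) z = 0)"

definition assumption_A5 ::
    "real \<Rightarrow> 'a::euclidean_space set \<Rightarrow> (real \<times> 'a \<Rightarrow> real) set \<Rightarrow> bool" where
  "assumption_A5 T X C \<longleftrightarrow>
     (\<forall>v\<in>C. \<forall>w\<in>C. (\<lambda>z. v z * w z) \<in> C) \<and> separates_points C ({0..T} \<times> X)"

definition assumption_A6 ::
    "real \<Rightarrow> 'a::euclidean_space set \<Rightarrow> (real \<times> 'a \<Rightarrow> real) set \<Rightarrow>
     ((real \<times> 'a \<Rightarrow> real) \<Rightarrow> real \<times> 'a \<Rightarrow> real) \<Rightarrow> bool" where
  "assumption_A6 T X C L \<longleftrightarrow>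
     (\<exists>V\<subseteq>C. countable V \<and> (\<forall>v\<in>C. (v, L v) \<in> bp_closure ({0..T} \<times> X) (graph_span L V)))"

text \<open>The augmented generator \<open>L\<close>-hat acts on \<open>(t, x)\<close> with \<open>s\<close> as a parameter.\<close>

definition aug_gen ::
    "((real \<times> 'a \<Rightarrow> real) \<Rightarrow> real \<times> 'a \<Rightarrow> real) \<Rightarrow>
     (real \<times> real \<times> 'a \<Rightarrow> real) \<Rightarrow> real \<times> real \<times> 'a \<Rightarrow> real" where
  "aug_gen L v = (\<lambda>(s, t, x). L (\<lambda>(t', x'). v (s, t', x')) (t, x))"

definition aug_dom ::
    "real \<Rightarrow> real \<Rightarrow> 'a::euclidean_space set \<Rightarrow> (real \<times> 'a \<Rightarrow> real) set \<Rightarrow>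
     ((real \<times> 'a \<Rightarrow> real) \<Rightarrow> real \<times> 'a \<Rightarrow> real) \<Rightarrow> (real \<times> real \<times> 'a \<Rightarrow> real) set" where
  "aug_dom T h X C L =
     {v. continuous_on ({h..T} \<times> {0..T} \<times> X) v \<and>
         (\<forall>s\<in>{h..T}. (\<lambda>(t, x). v (s, t, x)) \<in> C) \<and>
         continuous_on ({h..T} \<times> {0..T} \<times> X) (aug_gen L v)}"

text \<open>The supports \<open>\<Omega>\<^sub>+ \<times> X\<close> and \<open>\<Omega>\<^sub>- \<times> X\<close>.\<close>

definition supp_plus :: "real \<Rightarrow> real \<Rightarrow> 'a set \<Rightarrow> (real \<times> real \<times> 'a) set" where
  "supp_plus T h X =
     {(s, t, x). s \<in> {h..T} \<and> t \<in> {0..T} \<and> t \<in> {s - h..s} \<and> x \<in> X}"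

fun supp_minus :: "time_model \<Rightarrow> real \<Rightarrow> real \<Rightarrow> 'a set \<Rightarrow> (real \<times> real \<times> 'a) set" where
  "supp_minus Continuous_Time T h X =
     {(s, t, x). s \<in> {h..T} \<and> t \<in> {0..T} \<and> t \<in> {0..s - h} \<and> x \<in> X}"
| "supp_minus (Discrete_Time dt) T h X =
     {(s, t, x). s \<in> {h..T} \<and> t \<in> {0..T} \<and> t \<in> {0..s - h - dt} \<and> x \<in> X}"

text \<open>Nonnegative Radon measures on a compact set \<open>K\<close>; in a Euclidean space these are exactly the
  finite Borel measures on \<open>K\<close>.\<close>

definition radon_measures :: "'d::topological_space set \<Rightarrow> 'd measure set" where
  "radon_measures K = {\<mu>. sets \<mu> = sets (restrict_space borel K) \<and> finite_measure \<mu>}"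

text \<open>Feasible points \<open>(\<mu>\<^sub>0, \<mu>\<^sub>\<tau>, \<mu>\<^sub>+, \<mu>\<^sub>-)\<close> of the mean-type measure program.\<close>

definition measure_feasible ::
    "time_model \<Rightarrow> real \<Rightarrow> real \<Rightarrow> 'a::euclidean_space set \<Rightarrow> 'a set \<Rightarrow>
     (real \<times> 'a \<Rightarrow> real) set \<Rightarrow> ((real \<times> 'a \<Rightarrow> real) \<Rightarrow> real \<times> 'a \<Rightarrow> real) \<Rightarrow>
     ((real \<times> 'a) measure \<times> (real \<times> 'a) measure \<times>
      (real \<times> real \<times> 'a) measure \<times> (real \<times> real \<times> 'a) measure) set" where
  "measure_feasible tm T h X X0 C L =
     {(\<mu>0, \<mu>\<tau>, \<mu>p, \<mu>m).
        \<mu>0 \<in> radon_measures ({h..T} \<times> X0) \<and>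
        \<mu>\<tau> \<in> radon_measures ({h..T} \<times> X) \<and>
        \<mu>p \<in> radon_measures (supp_plus T h X) \<and>
        \<mu>m \<in> radon_measures (supp_minus tm T h X) \<and>
        (\<forall>v\<in>aug_dom T h X C L.
           (\<integral>(s, x). v (s, s, x) \<partial>\<mu>\<tau>) =
           (\<integral>(s, x). v (s, 0, x) \<partial>\<mu>0) +
           ((\<integral>z. aug_gen L v z \<partial>\<mu>m) + (\<integral>z. aug_gen L v z \<partial>\<mu>p))) \<and>
        (\<integral>z. 1 \<partial>\<mu>0) = (1::real) \<and>
        (\<integral>z. 1 \<partial>\<mu>p) = h}"

definition measure_objective ::
    "real \<Rightarrow> ('a \<Rightarrow> real) \<Rightarrow>
     ((real \<times> 'a) measure \<times> (real \<times> 'a) measure \<times>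
      (real \<times> real \<times> 'a) measure \<times> (real \<times> real \<times> 'a) measure) \<Rightarrow> real" where
  "measure_objective h p = (\<lambda>(\<mu>0, \<mu>\<tau>, \<mu>p, \<mu>m). (\<integral>(s, t, x). p x \<partial>\<mu>p) / h)"

definition p_star ::
    "time_model \<Rightarrow> real \<Rightarrow> real \<Rightarrow> 'a::euclidean_space set \<Rightarrow> 'a set \<Rightarrow> ('a \<Rightarrow> real) \<Rightarrow>
     (real \<times> 'a \<Rightarrow> real) set \<Rightarrow> ((real \<times> 'a \<Rightarrow> real) \<Rightarrow> real \<times> 'a \<Rightarrow> real) \<Rightarrow> ereal" where
  "p_star tm T h X X0 p C L =
     (SUP m \<in> measure_feasible tm T h X X0 C L. ereal (measure_objective h p m))"

text \<open>Feasible points \<open>(v, \<gamma>, \<xi>)\<close> of the mean-type function program.\<close>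

definition function_feasible ::
    "time_model \<Rightarrow> real \<Rightarrow> real \<Rightarrow> 'a::euclidean_space set \<Rightarrow> 'a set \<Rightarrow> ('a \<Rightarrow> real) \<Rightarrow>
     (real \<times> 'a \<Rightarrow> real) set \<Rightarrow> ((real \<times> 'a \<Rightarrow> real) \<Rightarrow> real \<times> 'a \<Rightarrow> real) \<Rightarrow>
     ((real \<times> real \<times> 'a \<Rightarrow> real) \<times> real \<times> real) set" where
  "function_feasible tm T h X X0 p C L =
     {(v, \<gamma>, \<xi>).
        v \<in> aug_dom T h X C L \<and>
        (\<forall>s\<in>{h..T}. \<forall>x\<in>X0. \<gamma> \<ge> v (s, 0, x)) \<and>
        (\<forall>s\<in>{h..T}. \<forall>x\<in>X. v (s, s, x) \<ge> 0) \<and>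
        (\<forall>(s, t, x)\<in>supp_plus T h X. aug_gen L v (s, t, x) + p x / h \<le> \<xi>) \<and>
        (\<forall>(s, t, x)\<in>supp_minus tm T h X. aug_gen L v (s, t, x) \<le> 0)}"

definition d_star ::
    "time_model \<Rightarrow> real \<Rightarrow> real \<Rightarrow> 'a::euclidean_space set \<Rightarrow> 'a set \<Rightarrow> ('a \<Rightarrow> real) \<Rightarrow>
     (real \<times> 'a \<Rightarrow> real) set \<Rightarrow> ((real \<times> 'a \<Rightarrow> real) \<Rightarrow> real \<times> 'a \<Rightarrow> real) \<Rightarrow> ereal" where
  "d_star tm T h X X0 p C L =
     (INF (v, \<gamma>, \<xi>) \<in> function_feasible tm T h X X0 p C L. ereal (\<gamma> + h * \<xi>))"

end

theory Submission
  imports Defs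
begin

text \<open>
  Both programs are linear, and optimal measures can be read off from a single linear functional on
  perturbations of the function program.

  Perturb the four constraints of the function program by bounded continuous functions
  \<open>(\<phi>\<^sub>0, \<phi>\<^sub>\<tau>, \<phi>\<^sub>+, \<phi>\<^sub>-)\<close>, one on each of the four compact supports. The pairs (perturbation, attainable
  value \<open>\<gamma> + h * \<xi>\<close>) form a convex cone \<open>perturbed_dual\<close>, and \<open>d_star\<close> is the infimum of its fibre over
  \<open>(0, 0, p / h, 0)\<close>. No fibre is empty (\<open>perturbed_dual_total\<close>): since constants and the time
  coordinate lie in the domain with images \<open>0\<close> and \<open>1\<close>, the function \<open>a - b * t\<close> with \<open>a\<close> and \<open>b\<close> large is
  feasible for any perturbation.

  If the fibre over \<open>0\<close> contains a negative value, then moving along this ray drives \<open>d_star\<close> to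
  \<open>-\<infinity>\<close>, and by weak duality the measure program is infeasible. Otherwise the infimum over a fibre
  is a finite sublinear function of the perturbation, and the Hahn-Banach theorem gives a linear
  functional below it that agrees with it at \<open>(0, 0, p / h, 0)\<close> (\<open>cone_value_functional\<close>). That functional
  is positive in each of the four components, so the Riesz representation theorem turns it into four
  measures. Testing it on the elements of the cone that come from a function \<open>v\<close>, from \<open>\<gamma>\<close> and from \<open>\<xi>\<close>
  gives the Liouville equation and the two mass constraints (\<open>measures_of_functional\<close>). The measures
  are therefore feasible, and their objective is \<open>d_star\<close>; weak duality makes them optimal.

  The Hahn-Banach theorem is obtained from Zorn's lemma, as minimal sublinear functionals are
  linear; the Riesz theorem on a compact metric space is obtained from Caratheodory's theorem, applied
  to the outer measure that the functional induces through open sets.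
\<close>

section \<open>Linear functionals below sublinear ones\<close>

definition sublinear :: "('a::real_vector \<Rightarrow> real) \<Rightarrow> bool" where
  "sublinear q \<longleftrightarrow> (\<forall>x y. q (x + y) \<le> q x + q y) \<and> (\<forall>a x. 0 \<le> a \<longrightarrow> q (a *\<^sub>R x) \<le> a * q x)"

lemma sublinear_add: "sublinear q \<Longrightarrow> q (x + y) \<le> q x + q y"
  and sublinear_scale: "sublinear q \<Longrightarrow> 0 \<le> a \<Longrightarrow> q (a *\<^sub>R x) \<le> a * q x"
  by (auto simp: sublinear_def)

lemma sublinear_lower: "sublinear q \<Longrightarrow> - q (- x) \<le> q x"
proof -
  assume q: "sublinear q"
  have "q 0 \<le> q 0 + q 0" "q 0 \<le> q x + q (- x)"
    using sublinear_add[OF q, of 0 0] sublinear_add[OF q, of x "- x"] by auto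
  then show ?thesis by linarith
qed

text \<open>
  Replacing \<open>q\<close> by this function lowers it as far as sublinearity permits while the value at \<open>y\<close> is
  kept: it is the largest sublinear functional below \<open>q\<close> whose value at \<open>-y\<close> is at most \<open>- q y\<close>.
\<close>

definition lower_along :: "('a::real_vector \<Rightarrow> real) \<Rightarrow> 'a \<Rightarrow> 'a \<Rightarrow> real" where
  "lower_along q y x = (INF t\<in>{0..}. q (x + t *\<^sub>R y) - t * q y)"

lemma lower_along_le:
  assumes q: "sublinear q" and "0 \<le> t"
  shows "lower_along q y x \<le> q (x + t *\<^sub>R y) - t * q y"
  unfolding lower_along_def
proof (rule cINF_lower)
  show "bdd_below ((\<lambda>t. q (x + t *\<^sub>R y) - t * q y) ` {0..})"
  proof (rule bdd_belowI2)
    fix t :: real assume "t \<in> {0..}"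
    moreover have "q (t *\<^sub>R y) \<le> q (x + t *\<^sub>R y) + q (- x)"
      using sublinear_add[OF q, of "x + t *\<^sub>R y" "- x"] by simp
    moreover have "t * q y \<le> q (t *\<^sub>R y)" if "0 < t"
      using sublinear_scale[OF q, of "1 / t" "t *\<^sub>R y"] that by (simp add: field_simps)
    moreover have "0 \<le> q 0" using sublinear_add[OF q, of 0 0] by simp
    ultimately show "- q (- x) \<le> q (x + t *\<^sub>R y) - t * q y"
      by (cases "t = 0") auto
  qed
qed (use assms in auto)

lemma sublinear_lower_along:
  assumes q: "sublinear q"
  shows "sublinear (lower_along q y)"
  unfolding sublinear_def
proof (intro conjI allI impI)
  fix x z
  have "lower_along q y (x + z) - (q (x + t *\<^sub>R y) - t * q y) \<le> lower_along q y z" if t: "t \<ge> 0" for t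
    unfolding lower_along_def[of q y z]
  proof (rule cINF_greatest)
    fix u :: real assume u: "u \<in> {0..}"
    have "lower_along q y (x + z) \<le> q ((x + z) + (t + u) *\<^sub>R y) - (t + u) * q y"
      by (rule lower_along_le[OF q]) (use t u in auto)
    moreover have "q ((x + z) + (t + u) *\<^sub>R y) \<le> q (x + t *\<^sub>R y) + q (z + u *\<^sub>R y)"
      using sublinear_add[OF q, of "x + t *\<^sub>R y" "z + u *\<^sub>R y"] by (simp add: algebra_simps)
    ultimately show "lower_along q y (x + z) - (q (x + t *\<^sub>R y) - t * q y) \<le> q (z + u *\<^sub>R y) - u * q y"
      by (simp add: algebra_simps)
  qed simp
  then have "lower_along q y (x + z) - lower_along q y z \<le> lower_along q y x"
    unfolding lower_along_def[of q y x] by (intro cINF_greatest) (auto simp: algebra_simps)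
  then show "lower_along q y (x + z) \<le> lower_along q y x + lower_along q y z" by simp
next
  fix a :: real and x assume a: "0 \<le> a"
  have *: "lower_along q y (a *\<^sub>R x) \<le> a * (q (x + t *\<^sub>R y) - t * q y)" if t: "t \<ge> 0" for t
  proof -
    have "lower_along q y (a *\<^sub>R x) \<le> q (a *\<^sub>R x + (a * t) *\<^sub>R y) - (a * t) * q y"
      by (rule lower_along_le[OF q]) (use t a in auto)
    also have "q (a *\<^sub>R x + (a * t) *\<^sub>R y) \<le> a * q (x + t *\<^sub>R y)"
      using sublinear_scale[OF q a, of "x + t *\<^sub>R y"] by (simp add: algebra_simps)
    finally show ?thesis by (simp add: algebra_simps)
  qed
  show "lower_along q y (a *\<^sub>R x) \<le> a * lower_along q y x"
  proof (cases "a = 0")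
    case True then show ?thesis using *[of 0] by simp
  next
    case False
    then have "lower_along q y (a *\<^sub>R x) / a \<le> lower_along q y x"
      unfolding lower_along_def[of q y x] using * a
      by (intro cINF_greatest) (auto simp: field_simps)
    then show ?thesis using False a by (simp add: field_simps)
  qed
qed

text \<open>
  A minimal \<open>q\<close> cannot be lowered along any \<open>y\<close>, so \<open>q x \<le> q (x + y) - q y\<close>. This is superadditivity.
\<close>

lemma minimal_sublinear_linear:
  assumes q: "sublinear q" and min: "\<And>p. sublinear p \<Longrightarrow> p \<le> q \<Longrightarrow> p = q"
  shows "linear q"
proof -
  have eq: "lower_along q y = q" for y
    using lower_along_le[OF q, of 0 y]
    by (intro min sublinear_lower_along q) (simp add: le_fun_def)
  have add: "q (x + y) = q x + q y" for x y
    using lower_along_le[OF q, of 1 y x] sublinear_add[OF q, of x y] eq[of y] by simp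
  have q0: "q 0 = 0" using add[of 0 0] by simp
  have neg: "q (- x) = - q x" for x using add[of x "- x"] q0 by simp
  have le: "a * q x \<le> q (a *\<^sub>R x)" if "0 \<le> a" for a x
    using sublinear_scale[OF q that, of "- x"] by (simp add: neg)
  have pos: "q (a *\<^sub>R x) = a * q x" if "0 \<le> a" for a x
    using le[OF that] sublinear_scale[OF q that] by (intro antisym) auto
  have "q (a *\<^sub>R x) = a * q x" for a x
  proof (cases "0 \<le> a")
    case False
    then show ?thesis using pos[of "- a" x] neg[of "a *\<^sub>R x"] by simp
  qed (rule pos)
  then show ?thesis by (intro linearI) (auto simp: add)
qed

text \<open>
  The pointwise infimum of a chain is finite because \<open>p x \<ge> - p (-x) \<ge> - q (-x)\<close> for every \<open>p \<le> q\<close>; it is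
  subadditive because any two members of the chain have a common lower bound in the chain.
\<close>

lemma sublinear_chain_INF:
  assumes C: "\<And>p. p \<in> C \<Longrightarrow> sublinear p" "\<And>p. p \<in> C \<Longrightarrow> p \<le> q" "C \<noteq> {}"
    and chain: "\<And>p p'. p \<in> C \<Longrightarrow> p' \<in> C \<Longrightarrow> p \<le> p' \<or> p' \<le> p"
  defines "r \<equiv> \<lambda>x. INF p\<in>C. p x"
  shows "sublinear r" "\<And>p. p \<in> C \<Longrightarrow> r \<le> p"
proof -
  have bdd: "bdd_below ((\<lambda>p. p x) ` C)" for x
  proof (rule bdd_belowI2)
    fix p assume p: "p \<in> C"
    show "- q (- x) \<le> p x"
      using sublinear_lower[OF C(1)[OF p], of x] C(2)[OF p] by (auto simp: le_fun_def intro: order_trans[rotated])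
  qed
  show *: "r \<le> p" if "p \<in> C" for p
    unfolding r_def le_fun_def using that bdd by (auto intro!: cINF_lower)
  show "sublinear r"
    unfolding sublinear_def
  proof (intro conjI allI impI)
    fix x y
    have sum: "r (x + y) \<le> p x + p' y" if p: "p \<in> C" "p' \<in> C" for p p'
    proof -
      obtain m where m: "m \<in> C" "m \<le> p" "m \<le> p'" using chain p by blast
      have "r (x + y) \<le> m (x + y)" using *[OF m(1)] by (simp add: le_fun_def)
      also have "\<dots> \<le> m x + m y" by (rule sublinear_add[OF C(1)[OF m(1)]])
      also have "\<dots> \<le> p x + p' y" using m by (auto simp: le_fun_def intro: add_mono)
      finally show ?thesis .
    qed
    have "r (x + y) - p x \<le> r y" if "p \<in> C" for p
      using C(3) sum[OF that] unfolding r_def by (intro cINF_greatest) (auto simp: algebra_simps)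
    then have "r (x + y) - r y \<le> r x"
      unfolding r_def using C(3) by (intro cINF_greatest) (auto simp: algebra_simps)
    then show "r (x + y) \<le> r x + r y" by simp
  next
    fix a :: real and x assume a: "0 \<le> a"
    have le: "r (a *\<^sub>R x) \<le> a * p x" if p: "p \<in> C" for p
      using *[OF p] sublinear_scale[OF C(1)[OF p] a, of x] by (auto simp: le_fun_def intro: order_trans)
    show "r (a *\<^sub>R x) \<le> a * r x"
    proof (cases "a = 0")
      case True then show ?thesis using le C(3) by auto
    next
      case False
      then have "r (a *\<^sub>R x) / a \<le> r x"
        unfolding r_def using le a C(3) unfolding r_def by (intro cINF_greatest) (auto simp: field_simps)
      then show ?thesis using False a by (simp add: field_simps)
    qed
  qed
qed

text \<open>
  Zorn's lemma gives a minimal, hence linear, functional below \<open>lower_along q x0\<close>. Starting from this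
  functional instead of \<open>q\<close> enforces \<open>f (- x0) \<le> - q x0\<close>, which is equality at \<open>x0\<close>.
\<close>

theorem Hahn_Banach_sublinear:
  fixes q :: "'a::real_vector \<Rightarrow> real"
  assumes q: "sublinear q"
  obtains f where "linear f" "\<And>x. f x \<le> q x" "f x0 = q x0"
proof -
  define q' where "q' = lower_along q x0"
  have q': "sublinear q'" unfolding q'_def by (rule sublinear_lower_along[OF q])
  define A where "A = {p. sublinear p \<and> p \<le> q'}"
  have "\<exists>m\<in>A. \<forall>a\<in>A. a \<le> m \<longrightarrow> a = m"
  proof (rule predicate_Zorn[where P = "\<lambda>x y. y \<le> x", simplified])
    show "partial_order_on A (relation_of (\<lambda>x y. y \<le> x) A)"
      by (auto simp: partial_order_on_def preorder_on_def refl_on_def trans_def antisym_def relation_of_def)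
  next
    fix C assume C: "C \<in> Chains (relation_of (\<lambda>x y. y \<le> x) A)"
    then have ch: "p \<in> A" "p \<le> p' \<or> p' \<le> p" if "p \<in> C" "p' \<in> C" for p p'
      using that by (auto simp: Chains_def relation_of_def)
    show "\<exists>u\<in>A. \<forall>a\<in>C. u \<le> a"
    proof (cases "C = {}")
      case True then show ?thesis using q' by (auto simp: A_def)
    next
      case False
      note r = sublinear_chain_INF[of C q', OF _ _ False]
      have "sublinear (\<lambda>x. INF p\<in>C. p x)"
        using ch by (intro r) (auto simp: A_def)
      moreover have le: "(\<lambda>x. INF p\<in>C. p x) \<le> p" if "p \<in> C" for p
        using ch that by (intro r) (auto simp: A_def)
      moreover obtain p where "p \<in> C" using False by auto
      ultimately show ?thesis using ch[of p] by (auto simp: A_def intro!: bexI[of _ "\<lambda>x. INF p\<in>C. p x"] intro: order_trans)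
    qed
  qed
  then obtain f where f: "sublinear f" "f \<le> q'" and min: "\<And>p. sublinear p \<Longrightarrow> p \<le> q' \<Longrightarrow> p \<le> f \<Longrightarrow> p = f"
    by (auto simp: A_def)
  have lin: "linear f" by (rule minimal_sublinear_linear[OF f(1)]) (use min f(2) order_trans in blast)
  have le: "f x \<le> q x" for x
    using f(2) lower_along_le[OF q, of 0 x0 x] by (auto simp: q'_def le_fun_def intro: order_trans)
  have "q 0 \<le> 0" using sublinear_scale[OF q, of 0 0] by simp
  then have "q' (- x0) \<le> - q x0" using lower_along_le[OF q, of 1 x0 "- x0"] by (simp add: q'_def)
  moreover have "- f x0 \<le> q' (- x0)" using f(2) linear_neg[OF lin, of x0] by (metis le_funD)
  ultimately have "f x0 = q x0" using le[of x0] by simp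
  with that lin le show thesis by blast
qed

text \<open>
  A member of the fibre over \<open>-e\<close> bounds the fibre over \<open>e\<close> from below, since their sum lies over \<open>0\<close>.
\<close>

lemma cone_fibre_bdd_below:
  fixes G :: "('e::real_vector \<times> real) set"
  assumes add: "\<And>e r e' r'. (e, r) \<in> G \<Longrightarrow> (e', r') \<in> G \<Longrightarrow> (e + e', r + r') \<in> G"
    and total: "\<And>e. \<exists>r. (e, r) \<in> G"
    and proper: "\<And>r. (0, r) \<in> G \<Longrightarrow> 0 \<le> r"
  shows "bdd_below {r. (e, r) \<in> G}"
proof -
  obtain c where c: "(- e, c) \<in> G" using total by blast
  have "- c \<le> r" if "(e, r) \<in> G" for r
    using proper[of "r + c"] add[OF that c] by simp
  then show ?thesis by (auto intro: bdd_belowI[of _ "- c"])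
qed

text \<open>
  Abstract form of strong duality. \<open>G\<close> consists of the pairs of a perturbation and a value attainable
  under it, so \<open>Inf {r. (e, r) \<in> G}\<close> is the value function of a minimisation problem, and \<open>f\<close> is a
  multiplier for that problem at \<open>e0\<close>.
\<close>

theorem cone_value_functional:
  fixes G :: "('e::real_vector \<times> real) set"
  assumes add: "\<And>e r e' r'. (e, r) \<in> G \<Longrightarrow> (e', r') \<in> G \<Longrightarrow> (e + e', r + r') \<in> G"
    and scale: "\<And>a e r. 0 \<le> a \<Longrightarrow> (e, r) \<in> G \<Longrightarrow> (a *\<^sub>R e, a * r) \<in> G"
    and total: "\<And>e. \<exists>r. (e, r) \<in> G"
    and proper: "\<And>r. (0, r) \<in> G \<Longrightarrow> 0 \<le> r"
  shows "\<exists>f. linear f \<and> (\<forall>e r. (e, r) \<in> G \<longrightarrow> f e \<le> r) \<and> f e0 = Inf {r. (e0, r) \<in> G}"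
proof -
  define q where "q e = Inf {r. (e, r) \<in> G}" for e
  have bdd: "bdd_below {r. (e, r) \<in> G}" for e
    by (rule cone_fibre_bdd_below) (erule (1) add, rule total, erule proper)
  have le: "q e \<le> r" if "(e, r) \<in> G" for e r
    unfolding q_def using that bdd by (intro cInf_lower) auto
  have ge: "c \<le> q e" if "\<And>r. (e, r) \<in> G \<Longrightarrow> c \<le> r" for e c
    unfolding q_def using that total by (intro cInf_greatest) auto
  have "sublinear q"
    unfolding sublinear_def
  proof (intro conjI allI impI)
    fix x y
    have "q (x + y) - r \<le> q y" if "(x, r) \<in> G" for r
    proof (rule ge)
      fix u assume "(y, u) \<in> G"
      from le[OF add[OF that this]] show "q (x + y) - r \<le> u" by simp
    qed
    then have "q (x + y) - q y \<le> q x" by (intro ge) (auto simp: algebra_simps)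
    then show "q (x + y) \<le> q x + q y" by simp
  next
    fix a :: real and x assume a: "0 \<le> a"
    show "q (a *\<^sub>R x) \<le> a * q x"
    proof (cases "a = 0")
      case True
      obtain r where "(x, r) \<in> G" using total by blast
      from le[OF scale[OF a this]] show ?thesis using True by simp
    next
      case False
      then have "q (a *\<^sub>R x) / a \<le> q x"
        using a le[OF scale[OF a]] by (intro ge) (auto simp: field_simps)
      then show ?thesis using False a by (simp add: field_simps)
    qed
  qed
  then obtain f where "linear f" "\<And>x. f x \<le> q x" "f e0 = q e0"
    using Hahn_Banach_sublinear[of q e0] by blast
  then show ?thesis using le by (intro exI[of _ f]) (auto simp: q_def intro: order_trans)
qed

section \<open>The Riesz representation theorem on compact sets\<close>

lemma radon_measures_space: "\<mu> \<in> radon_measures K \<Longrightarrow> space \<mu> = K"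
  using sets_eq_imp_space_eq[of \<mu> "restrict_space borel K"] by (auto simp: radon_measures_def space_restrict_space)

lemma radon_measures_integrable:
  fixes f :: "'d::topological_space \<Rightarrow> real"
  assumes K: "compact K" and \<mu>: "\<mu> \<in> radon_measures K" and f: "continuous_on K f"
  shows "integrable \<mu> f"
proof -
  interpret finite_measure \<mu> using \<mu> by (simp add: radon_measures_def)
  have "sets \<mu> = sets (restrict_space borel K)" using \<mu> by (simp add: radon_measures_def)
  then have meas: "f \<in> borel_measurable \<mu>"
    using borel_measurable_continuous_on_restrict[OF f] by (simp cong: measurable_cong_sets)
  have "bounded (f ` K)" using compact_continuous_image[OF f K] by (rule compact_imp_bounded)
  then obtain B where "\<And>x. x \<in> K \<Longrightarrow> norm (f x) \<le> B" by (auto simp: bounded_iff)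
  then show ?thesis
    using meas by (intro integrable_const_bound[of _ B]) (auto simp: radon_measures_space[OF \<mu>])
qed

locale positive_functional =
  fixes K :: "'a::metric_space set" and \<Lambda> :: "('a \<Rightarrow> real) \<Rightarrow> real"
  assumes compact: "compact K"
    and add: "\<And>f g. continuous_on K f \<Longrightarrow> continuous_on K g \<Longrightarrow> \<Lambda> (\<lambda>x. f x + g x) = \<Lambda> f + \<Lambda> g"
    and scale: "\<And>c f. continuous_on K f \<Longrightarrow> \<Lambda> (\<lambda>x. c * f x) = c * \<Lambda> f"
    and positive: "\<And>f. continuous_on K f \<Longrightarrow> (\<And>x. x \<in> K \<Longrightarrow> 0 \<le> f x) \<Longrightarrow> 0 \<le> \<Lambda> f"
begin

lemma minus: "continuous_on K f \<Longrightarrow> \<Lambda> (\<lambda>x. - f x) = - \<Lambda> f"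
  using scale[of f "-1"] by simp

lemma diff: "continuous_on K f \<Longrightarrow> continuous_on K g \<Longrightarrow> \<Lambda> (\<lambda>x. f x - g x) = \<Lambda> f - \<Lambda> g"
  using add[of f "\<lambda>x. - g x"] minus[of g] by (simp add: continuous_intros)

lemma const: "\<Lambda> (\<lambda>x. c) = c * \<Lambda> (\<lambda>x. 1)"
  using scale[of "\<lambda>x. 1" c] by simp

lemma mono:
  assumes "continuous_on K f" "continuous_on K g" "\<And>x. x \<in> K \<Longrightarrow> f x \<le> g x"
  shows "\<Lambda> f \<le> \<Lambda> g"
  using positive[of "\<lambda>x. g x - f x"] diff[of g f] assms by (auto simp: continuous_intros)

lemma sum:
  "finite I \<Longrightarrow> (\<And>i. i \<in> I \<Longrightarrow> continuous_on K (f i)) \<Longrightarrow> \<Lambda> (\<lambda>x. \<Sum>i\<in>I. f i x) = (\<Sum>i\<in>I. \<Lambda> (f i))"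
proof (induction I rule: finite_induct)
  case empty then show ?case using const[of 0] by simp
next
  case (insert i I)
  then show ?case using add[of "f i" "\<lambda>x. \<Sum>i\<in>I. f i x"] by (simp add: continuous_intros)
qed

text \<open>
  The measure of an open set \<open>U\<close> has to be the supremum of \<open>\<Lambda> f\<close> over the continuous \<open>f\<close> between \<open>0\<close> and
  the indicator of \<open>U\<close> on \<open>K\<close>. Open sets are taken in the ambient space and only their traces on \<open>K\<close>
  matter, which gives an outer measure on the whole type that is concentrated on \<open>K\<close>.
\<close>

definition dominated :: "'a set \<Rightarrow> ('a \<Rightarrow> real) set" where
  "dominated U = {f. continuous_on K f \<and> (\<forall>x\<in>K. 0 \<le> f x \<and> f x \<le> indicator U x)}"

definition content :: "'a set \<Rightarrow> ennreal" where
  "content U = (SUP f\<in>dominated U. ennreal (\<Lambda> f))"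

definition outer :: "'a set \<Rightarrow> ennreal" where
  "outer A = (INF U\<in>{U. open U \<and> A \<subseteq> U}. content U)"

lemma dominatedD:
  assumes "f \<in> dominated U"
  shows "continuous_on K f" "\<And>x. x \<in> K \<Longrightarrow> 0 \<le> f x" "\<And>x. x \<in> K \<Longrightarrow> f x \<le> 1"
    "\<And>x. x \<in> K \<Longrightarrow> x \<notin> U \<Longrightarrow> f x = 0" "0 \<le> \<Lambda> f"
proof -
  show *: "continuous_on K f" "\<And>x. x \<in> K \<Longrightarrow> 0 \<le> f x" using assms by (auto simp: dominated_def)
  have le: "f x \<le> indicator U x" if "x \<in> K" for x using assms that by (auto simp: dominated_def)
  show "f x \<le> 1" if "x \<in> K" for x using le[OF that] by (cases "x \<in> U") auto
  show "f x = 0" if "x \<in> K" "x \<notin> U" for x using le[OF that(1)] *(2)[OF that(1)] that by simp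
  show "0 \<le> \<Lambda> f" using * by (rule positive)
qed

lemma dominatedI:
  "continuous_on K f \<Longrightarrow> (\<And>x. x \<in> K \<Longrightarrow> 0 \<le> f x) \<Longrightarrow> (\<And>x. x \<in> K \<Longrightarrow> f x \<le> 1) \<Longrightarrow>
   (\<And>x. x \<in> K \<Longrightarrow> x \<notin> U \<Longrightarrow> f x \<le> 0) \<Longrightarrow> f \<in> dominated U"
  by (auto simp: dominated_def indicator_def)

lemma zero_dominated: "(\<lambda>x. 0) \<in> dominated U"
  by (auto intro: dominatedI)

lemma content_upper: "f \<in> dominated U \<Longrightarrow> ennreal (\<Lambda> f) \<le> content U"
  unfolding content_def by (rule SUP_upper)

lemma outer_le_content: "open U \<Longrightarrow> A \<subseteq> U \<Longrightarrow> outer A \<le> content U"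
  unfolding outer_def by (rule INF_lower) auto

lemma outer_mono: "A \<subseteq> B \<Longrightarrow> outer A \<le> outer B"
  unfolding outer_def by (rule INF_superset_mono) auto

lemma content_le: "content U \<le> ennreal (\<Lambda> (\<lambda>x. 1))"
  unfolding content_def
  by (intro SUP_least ennreal_leI mono) (auto dest: dominatedD)

lemma outer_empty: "outer {} = 0"
proof -
  have "ennreal (\<Lambda> f) \<le> 0" if "f \<in> dominated {}" for f
  proof -
    have "\<Lambda> f \<le> \<Lambda> (\<lambda>x. 0)" using dominatedD[OF that] by (intro mono) auto
    then show ?thesis using const[of 0] by (simp add: ennreal_neg)
  qed
  then have "content {} \<le> 0" unfolding content_def by (intro SUP_least)
  with outer_le_content[of "{}" "{}"] show ?thesis by simp
qed

text \<open>
  Compactness enters here. The functions \<open>min 1 (n * e\<^sub>i)\<close>, with \<open>e\<^sub>i\<close> continuous and positive exactly on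
  \<open>U i\<close>, increase to the indicators of the sets \<open>U i\<close>. The sets where their partial sums stay below
  \<open>f - \<epsilon>\<close> are therefore decreasing and closed with empty intersection, so one of them is empty.
\<close>

lemma truncated_le_sum_of_bumps:
  assumes U: "\<And>i::nat. open (U i)" and f: "f \<in> dominated (\<Union>i. U i)" and "0 < \<epsilon>"
  obtains n g where "\<And>i. g i \<in> dominated (U i)" "\<And>x. x \<in> K \<Longrightarrow> f x \<le> (\<Sum>i<n. g i x) + \<epsilon>"
proof -
  note f = dominatedD[OF f]
  \<comment> \<open>\<open>infdist\<close> to the empty set is \<open>0\<close>, so \<open>U i = UNIV\<close> is treated separately.\<close>
  define e where "e i x = (if U i = UNIV then 1 else infdist x (- U i))" for i x
  have cont_e: "continuous_on A (e i)" for A i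
    by (cases "U i = UNIV") (auto simp: e_def[abs_def] intro!: continuous_intros)
  have e: "0 \<le> e i x" for i x by (simp add: e_def infdist_nonneg)
  have e0: "e i x = 0" if "x \<notin> U i" for i x using that by (auto simp: e_def)
  have e_pos: "0 < e i x" if "x \<in> U i" for i x
  proof (cases "U i = UNIV")
    case False
    moreover have "closed (- U i)" using U by auto
    ultimately show ?thesis
      using in_closed_iff_infdist_zero[of "- U i" x] that infdist_nonneg[of x "- U i"]
      by (auto simp: e_def less_le)
  qed (simp add: e_def)
  define g where "g n i x = min 1 (real n * e i x)" for n i x
  have cont_g: "continuous_on A (g n i)" for A n i
    unfolding g_def[abs_def] by (intro continuous_intros cont_e)
  have g: "g n i \<in> dominated (U i)" for n i
    by (rule dominatedI) (auto simp: cont_g, auto simp: g_def e e0)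
  define F where "F n = {x \<in> K. (\<Sum>i<n. g n i x) \<le> f x - \<epsilon>}" for n
  have "\<exists>n. F n = {}"
  proof (rule ccontr)
    assume nonempty: "\<nexists>n. F n = {}"
    have closed: "closed (F n)" for n
    proof -
      have "continuous_on K (\<lambda>x. f x - \<epsilon> - (\<Sum>i<n. g n i x))"
        by (intro continuous_intros f cont_g)
      from continuous_closed_preimage[OF this compact_imp_closed[OF compact], of "{0..}"]
      show ?thesis by (simp add: F_def vimage_def Int_def)
    qed
    have decreasing: "F n \<subseteq> F m" if "m \<le> n" for m n
    proof
      fix x assume x: "x \<in> F n"
      have "(\<Sum>i<m. g m i x) \<le> (\<Sum>i<m. g n i x)"
        using that e by (intro sum_mono) (simp only: g_def min.mono mult_right_mono of_nat_mono order_refl)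
      also have "\<dots> \<le> (\<Sum>i<n. g n i x)"
        using that by (intro sum_mono2) (auto simp: g_def e)
      finally show "x \<in> F m" using x by (auto simp: F_def)
    qed
    have "K \<inter> \<Inter> (range F) \<noteq> {}"
    proof (rule compact_imp_fip_image[OF compact closed])
      fix I :: "nat set" assume "finite I"
      then have "F (Max (insert 0 I)) \<subseteq> F i" if "i \<in> I" for i
        using that by (intro decreasing) simp
      moreover have "F (Max (insert 0 I)) \<subseteq> K" by (auto simp: F_def)
      ultimately have "F (Max (insert 0 I)) \<subseteq> K \<inter> \<Inter> (F ` I)" by blast
      then show "K \<inter> \<Inter> (F ` I) \<noteq> {}" using nonempty by blast
    qed
    then obtain x where x: "\<And>n. x \<in> F n" by auto
    then have xK: "x \<in> K" by (auto simp: F_def)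
    have "0 < f x" using x[of 0] \<open>0 < \<epsilon>\<close> by (auto simp: F_def)
    with f(4)[OF xK] obtain i where i: "x \<in> U i" by force
    from e_pos[OF i] obtain n where n: "1 < real n * e i x"
      using ex_less_of_nat_mult by blast
    define m where "m = max n (Suc i)"
    have "real n * e i x \<le> real m * e i x" by (intro mult_right_mono e) (auto simp: m_def)
    then have "g m i x = 1" using n by (auto simp: g_def)
    moreover have "g m i x \<le> (\<Sum>i<m. g m i x)"
      by (rule member_le_sum) (auto simp: m_def g_def e)
    ultimately show False using x[of m] f(3)[OF xK] \<open>0 < \<epsilon>\<close> by (auto simp: F_def)
  qed
  then obtain n where "F n = {}" ..
  then have "f x \<le> (\<Sum>i<n. g n i x) + \<epsilon>" if "x \<in> K" for x
    using that by (force simp: F_def)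
  with g that show thesis by blast
qed

lemma content_countably_subadditive:
  assumes U: "\<And>i::nat. open (U i)"
  shows "content (\<Union>i. U i) \<le> (\<Sum>i. content (U i))"
  unfolding content_def[of "\<Union>i. U i"]
proof (rule SUP_least)
  fix f assume f: "f \<in> dominated (\<Union>i. U i)"
  let ?c = "\<Lambda> (\<lambda>x. 1)"
  have c: "0 \<le> ?c" by (rule positive) auto
  show "ennreal (\<Lambda> f) \<le> (\<Sum>i. content (U i))"
  proof (rule ennreal_le_epsilon)
    fix e :: real assume "0 < e"
    define \<epsilon> where "\<epsilon> = e / (?c + 1)"
    have \<epsilon>: "0 < \<epsilon>" "\<epsilon> * ?c \<le> e" using \<open>0 < e\<close> c by (auto simp: \<epsilon>_def field_simps)
    obtain n g where g: "\<And>i. g i \<in> dominated (U i)" and le: "\<And>x. x \<in> K \<Longrightarrow> f x \<le> (\<Sum>i<n. g i x) + \<epsilon>"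
      using truncated_le_sum_of_bumps[OF U f \<epsilon>(1)] by metis
    have "\<Lambda> f \<le> \<Lambda> (\<lambda>x. (\<Sum>i<n. g i x) + \<epsilon>)"
      using le by (intro mono continuous_intros dominatedD[OF f] dominatedD[OF g])
    also have "\<dots> = (\<Sum>i<n. \<Lambda> (g i)) + \<epsilon> * ?c"
      using dominatedD[OF g] by (subst add) (auto simp: sum const[of \<epsilon>] intro!: continuous_intros)
    also have "\<dots> \<le> (\<Sum>i<n. \<Lambda> (g i)) + e" using \<epsilon> by simp
    finally have "ennreal (\<Lambda> f) \<le> ennreal ((\<Sum>i<n. \<Lambda> (g i)) + e)" by (rule ennreal_leI)
    also have "\<dots> = (\<Sum>i<n. ennreal (\<Lambda> (g i))) + ennreal e"
      using dominatedD(5)[OF g] \<open>0 < e\<close> by (simp add: sum_nonneg sum_ennreal)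
    also have "(\<Sum>i<n. ennreal (\<Lambda> (g i))) \<le> (\<Sum>i<n. content (U i))"
      by (intro sum_mono content_upper g)
    also have "\<dots> \<le> (\<Sum>i. content (U i))" by (intro sum_le_suminf) auto
    finally show "ennreal (\<Lambda> f) \<le> (\<Sum>i. content (U i)) + ennreal e" by simp
  qed
qed

lemma outer_measure_space_outer: "outer_measure_space UNIV outer"
  unfolding outer_measure_space_def
proof (intro conjI)
  show "positive UNIV outer" by (simp add: positive_def outer_empty)
  show "increasing UNIV outer" by (simp add: increasing_def outer_mono)
  show "countably_subadditive UNIV outer"
    unfolding countably_subadditive_def
  proof (intro allI impI)
    fix A :: "nat \<Rightarrow> 'a set"
    show "outer (\<Union>i. A i) \<le> (\<Sum>i. outer (A i))"
    proof (rule ennreal_le_epsilon)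
      fix e :: real assume e: "0 < e"
      have "\<exists>U. open U \<and> A i \<subseteq> U \<and> content U \<le> outer (A i) + ennreal (e * (1/2)^Suc i)" for i
      proof -
        have "outer (A i) \<noteq> \<top>"
          using outer_le_content[of UNIV "A i"] content_le[of UNIV] by (auto simp: top_unique)
        then have "outer (A i) < outer (A i) + ennreal (e * (1/2)^Suc i)"
          using e ennreal_add_left_cancel_less[of "outer (A i)" 0 "ennreal (e * (1/2)^Suc i)"] by auto
        then have "\<exists>U\<in>{U. open U \<and> A i \<subseteq> U}. content U < outer (A i) + ennreal (e * (1/2)^Suc i)"
          unfolding outer_def by (simp only: INF_less_iff)
        then show ?thesis by (auto intro: less_imp_le)
      qed
      then obtain U where U: "\<And>i. open (U i)" "\<And>i. A i \<subseteq> U i"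
        "\<And>i. content (U i) \<le> outer (A i) + ennreal (e * (1/2)^Suc i)" by metis
      have "outer (\<Union>i. A i) \<le> content (\<Union>i. U i)"
        using U by (intro outer_le_content) auto
      also have "\<dots> \<le> (\<Sum>i. content (U i))" by (rule content_countably_subadditive[OF U(1)])
      also have "\<dots> \<le> (\<Sum>i. outer (A i) + ennreal (e * (1/2)^Suc i))"
        by (intro suminf_le U(3) summableI)
      also have "\<dots> = (\<Sum>i. outer (A i)) + (\<Sum>i. ennreal (e * (1/2)^Suc i))"
        by (intro suminf_add[symmetric] summableI)
      also have "(\<Sum>i. ennreal (e * (1/2)^Suc i)) = ennreal e"
        using e sums_mult[OF power_half_series, of e]
        by (subst suminf_ennreal_eq[where x = e]) auto
      finally show "outer (\<Union>i. A i) \<le> (\<Sum>i. outer (A i)) + ennreal e" .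
    qed
  qed
qed

text \<open>
  Caratheodory's condition for open \<open>U\<close>. If \<open>f\<close> lives on \<open>V \<inter> U\<close>, then \<open>V\<close> without \<open>{f \<ge> \<epsilon>}\<close> is an open
  set that contains \<open>V - U\<close>. Any \<open>g\<close> that lives on it vanishes where \<open>f \<ge> \<epsilon>\<close>, so the positive part of
  \<open>f - \<epsilon>\<close> can be added to \<open>g\<close> without exceeding the indicator of \<open>V\<close>.
\<close>

lemma open_lambda_system:
  assumes U: "open U"
  shows "U \<in> lambda_system UNIV UNIV outer"
proof -
  interpret sigma_algebra UNIV "UNIV :: 'a set set" using sigma_algebra_Pow[of UNIV] by simp
  let ?c = "\<Lambda> (\<lambda>x. 1)"
  have c: "0 \<le> ?c" by (rule positive) auto
  have *: "ennreal (\<Lambda> f) + outer (V - U) \<le> content V" if V: "open V" and f: "f \<in> dominated (V \<inter> U)" for V f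
  proof (rule ennreal_le_epsilon)
    fix e :: real assume "0 < e"
    define \<epsilon> where "\<epsilon> = e / (?c + 1)"
    have \<epsilon>: "0 < \<epsilon>" "\<epsilon> * ?c \<le> e" using \<open>0 < e\<close> c by (auto simp: \<epsilon>_def field_simps)
    note df = dominatedD[OF f]
    define W where "W = V - {x \<in> K. \<epsilon> \<le> f x}"
    have "closed {x \<in> K. \<epsilon> \<le> f x}"
      using continuous_closed_preimage[OF df(1) compact_imp_closed[OF compact], of "{\<epsilon>..}"]
      by (simp add: vimage_def Int_def)
    then have "open W" using V by (auto simp: W_def)
    moreover have "V - U \<subseteq> W" using \<epsilon>(1) df(4) by (auto simp: W_def)
    ultimately have "outer (V - U) \<le> content W" by (rule outer_le_content)
    moreover have "ennreal (\<Lambda> f) + content W \<le> content V + ennreal e"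
    proof -
      have "ennreal (\<Lambda> f) + ennreal (\<Lambda> g) \<le> content V + ennreal e" if g: "g \<in> dominated W" for g
      proof -
        note dg = dominatedD[OF g]
        let ?h = "\<lambda>x. max 0 (f x - \<epsilon>) + g x"
        have "?h \<in> dominated V"
        proof (rule dominatedI)
          show "continuous_on K ?h" by (intro continuous_intros df dg)
          fix x assume x: "x \<in> K"
          show "0 \<le> ?h x" using dg(2)[OF x] by simp
          show "?h x \<le> 1"
          proof (cases "\<epsilon> \<le> f x")
            case True
            then have "g x = 0" using x by (intro dg) (auto simp: W_def)
            then show ?thesis using df(3)[OF x] \<epsilon>(1) by simp
          next
            case False then show ?thesis using dg(3)[OF x] by simp
          qed
          show "?h x \<le> 0" if "x \<notin> V" using df(4)[OF x] dg(4)[OF x] \<epsilon>(1) that by (auto simp: W_def)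
        qed
        from content_upper[OF this] have h: "ennreal (\<Lambda> ?h) \<le> content V" .
        have "\<Lambda> f + \<Lambda> g = \<Lambda> (\<lambda>x. f x + g x)" using df dg by (simp add: add)
        also have "\<dots> \<le> \<Lambda> (\<lambda>x. ?h x + \<epsilon>)" by (intro mono continuous_intros df dg) auto
        also have "\<dots> = \<Lambda> ?h + \<epsilon> * ?c"
          using df dg by (subst add) (auto simp: const[of \<epsilon>] intro!: continuous_intros)
        also have "\<dots> \<le> \<Lambda> ?h + e" using \<epsilon> by simp
        finally have "ennreal (\<Lambda> f + \<Lambda> g) \<le> ennreal (\<Lambda> ?h + e)" by (rule ennreal_leI)
        also have "\<dots> = ennreal (\<Lambda> ?h) + ennreal e"
          using \<open>0 < e\<close> dominatedD(5)[OF \<open>?h \<in> dominated V\<close>] by simp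
        also have "\<dots> \<le> content V + ennreal e" using h by (rule add_right_mono)
        finally show ?thesis using df(5) dg(5) by simp
      qed
      then have "(SUP g\<in>dominated W. ennreal (\<Lambda> f) + ennreal (\<Lambda> g)) \<le> content V + ennreal e"
        by (intro SUP_least)
      then show ?thesis unfolding content_def[of W]
        using zero_dominated[of W] by (subst ennreal_SUP_add_right) auto
    qed
    ultimately show "ennreal (\<Lambda> f) + outer (V - U) \<le> content V + ennreal e"
      by (meson add_left_mono order_trans)
  qed
  have **: "content (V \<inter> U) + outer (V - U) \<le> content V" if "open V" for V
  proof -
    have "(SUP f\<in>dominated (V \<inter> U). ennreal (\<Lambda> f) + outer (V - U)) \<le> content V"
      using *[OF that] by (intro SUP_least)
    then show ?thesis unfolding content_def[of "V \<inter> U"]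
      using zero_dominated[of "V \<inter> U"] by (subst ennreal_SUP_add_left[symmetric]) auto
  qed
  have "outer (A \<inter> U) + outer (A - U) \<le> outer A" for A
    unfolding outer_def[of A]
  proof (rule INF_greatest)
    fix V assume "V \<in> {V. open V \<and> A \<subseteq> V}"
    then have V: "open V" "A \<subseteq> V" by auto
    have "outer (A \<inter> U) + outer (A - U) \<le> content (V \<inter> U) + outer (V - U)"
      using V U by (intro add_mono outer_le_content outer_mono) auto
    also have "\<dots> \<le> content V" using V by (intro **)
    finally show "outer (A \<inter> U) + outer (A - U) \<le> content V" .
  qed
  moreover have "outer A \<le> outer (A \<inter> U) + outer (A - U)" for A
  proof -
    have "subadditive UNIV outer"
      using outer_measure_space_outer countably_subadditive_subadditive
      by (auto simp: outer_measure_space_def)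
    from this[unfolded subadditive_def, rule_format, of "A \<inter> U" "A - U"]
    have "outer ((A \<inter> U) \<union> (A - U)) \<le> outer (A \<inter> U) + outer (A - U)" by auto
    then show ?thesis by (simp only: Int_Diff_Un)
  qed
  ultimately show ?thesis by (auto simp: lambda_system_eq intro: antisym)
qed

definition riesz_measure :: "'a measure" where
  "riesz_measure = restrict_space (measure_of UNIV (sets borel) outer) K"

lemma emeasure_outer: "A \<in> sets borel \<Longrightarrow> emeasure (measure_of UNIV (sets borel) outer) A = outer A"
proof -
  assume A: "A \<in> sets borel"
  interpret S: sigma_algebra UNIV "UNIV :: 'a set set" using sigma_algebra_Pow[of UNIV] by simp
  have ms: "measure_space UNIV (lambda_system UNIV UNIV outer) outer"
    by (rule S.caratheodory_lemma[OF outer_measure_space_outer])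
  then interpret L: sigma_algebra UNIV "lambda_system UNIV UNIV outer" by (simp add: measure_space_def)
  have sub: "sets borel \<subseteq> lambda_system UNIV UNIV outer"
  proof -
    have "sigma_sets UNIV {U :: 'a set. open U} \<subseteq> lambda_system UNIV UNIV outer"
      by (rule L.sigma_sets_subset) (use open_lambda_system in blast)
    then show ?thesis by (simp add: borel_def)
  qed
  have "measure_space UNIV (sets borel) outer"
    by (rule measure_down[OF ms _ sub]) (use sets.sigma_algebra_axioms[of "borel :: 'a measure"] in simp)
  then show ?thesis
    using A by (intro emeasure_measure_of_sigma) (auto simp: measure_space_def)
qed

lemma K_borel: "K \<in> sets borel" using compact by (intro borel_closed compact_imp_closed)

lemma sets_riesz_measure: "sets riesz_measure = sets (restrict_space borel K)"
  unfolding riesz_measure_def by (intro sets_restrict_space_cong) (simp add: sets.sets_measure_of_eq[of borel, simplified])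

lemma emeasure_riesz_measure:
  assumes "A \<in> sets borel" "A \<subseteq> K"
  shows "emeasure riesz_measure A = outer A"
  unfolding riesz_measure_def using assms K_borel
  by (subst emeasure_restrict_space) (auto simp: emeasure_outer)

lemma finite_measure_riesz_measure: "finite_measure riesz_measure"
  and measure_riesz_measure_le: "measure riesz_measure K \<le> \<Lambda> (\<lambda>x. 1)"
proof -
  have c: "0 \<le> \<Lambda> (\<lambda>x. 1)" by (rule positive) auto
  have le: "emeasure riesz_measure K \<le> ennreal (\<Lambda> (\<lambda>x. 1))"
    using outer_le_content[of UNIV K] content_le[of UNIV] emeasure_riesz_measure[OF K_borel] by auto
  have sp: "space riesz_measure = K"
    using sets_eq_imp_space_eq[OF sets_riesz_measure] by (simp add: space_restrict_space)
  show "finite_measure riesz_measure" using le sp by (intro finite_measureI) (auto simp: top_unique)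
  show "measure riesz_measure K \<le> \<Lambda> (\<lambda>x. 1)"
    using le c unfolding measure_def by (simp add: enn2real_leI)
qed

lemma space_riesz_measure: "space riesz_measure = K"
  using sets_eq_imp_space_eq[OF sets_riesz_measure] by (simp add: space_restrict_space)

text \<open>
  Any open set around \<open>{f > 0}\<close> dominates \<open>f\<close>, so the value \<open>\<Lambda> f\<close> is a lower bound for the outer measure.
\<close>

lemma le_outer_support:
  assumes f: "continuous_on K f" "\<And>x. x \<in> K \<Longrightarrow> 0 \<le> f x" "\<And>x. x \<in> K \<Longrightarrow> f x \<le> 1"
    and A: "\<And>x. x \<in> K \<Longrightarrow> 0 < f x \<Longrightarrow> x \<in> A"
  shows "ennreal (\<Lambda> f) \<le> outer A"
  unfolding outer_def
proof (rule INF_greatest)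
  fix V assume "V \<in> {V. open V \<and> A \<subseteq> V}"
  then show "ennreal (\<Lambda> f) \<le> content V"
    using A by (intro content_upper dominatedI f) (auto simp: not_less[symmetric])
qed

lemma riesz_measure_radon: "riesz_measure \<in> radon_measures K"
  by (simp add: radon_measures_def sets_riesz_measure finite_measure_riesz_measure)

lemmas integrable_riesz_measure = radon_measures_integrable[OF compact riesz_measure_radon]

text \<open>
  Layer-cake argument: \<open>n * f\<close> is the sum of the slices of \<open>n * f\<close> between \<open>k\<close> and \<open>k + 1\<close> for \<open>k < n\<close>, and
  \<open>\<Lambda>\<close> of the \<open>k\<close>-th slice is at most the measure of \<open>{f > k / n}\<close>. The indicators of these sets add
  up to at most \<open>n * f + 1\<close>, so the error after division by \<open>n\<close> vanishes as \<open>n\<close> grows.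
\<close>

lemma le_integral_unit_range:
  assumes f: "continuous_on K f" "\<And>x. x \<in> K \<Longrightarrow> 0 \<le> f x" "\<And>x. x \<in> K \<Longrightarrow> f x \<le> 1"
  shows "\<Lambda> f \<le> (\<integral>x. f x \<partial>riesz_measure)"
proof -
  interpret finite_measure riesz_measure by (rule finite_measure_riesz_measure)
  let ?m = "measure riesz_measure"
  have "\<Lambda> f \<le> (\<integral>x. f x \<partial>riesz_measure) + ?m K / real n" if n: "0 < n" for n :: nat
  proof -
    define S where "S k = {x \<in> K. real k / n < f x}" for k :: nat
    define s where "s k x = min 1 (max 0 (n * f x - real k))" for k x
    have cont_s: "continuous_on K (s k)" for k
      unfolding s_def[abs_def] by (intro continuous_intros f)
    have S_sets: "S k \<in> sets riesz_measure" for k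
    proof -
      have "f \<in> borel_measurable riesz_measure"
        using integrable_riesz_measure[OF f(1)] by simp
      from measurable_sets[OF this, of "{real k / n<..}"] show ?thesis
        by (simp add: S_def vimage_def Int_def space_riesz_measure conj_commute)
    qed
    have S_borel: "S k \<in> sets borel" for k
      using S_sets[of k] K_borel by (auto simp: sets_riesz_measure sets_restrict_space)
    have slices: "(\<Sum>k<N. s k x) = min N (max 0 (n * f x))" for x N
      by (induction N) (auto simp: s_def min_def max_def)
    have "n * \<Lambda> f = \<Lambda> (\<lambda>x. n * f x)" using scale[OF f(1)] by simp
    also have "\<dots> \<le> \<Lambda> (\<lambda>x. \<Sum>k<n. s k x)"
      using f n by (intro mono continuous_intros cont_s) (auto simp: slices min_def max_def mult_le_cancel_left1)
    also have "\<dots> = (\<Sum>k<n. \<Lambda> (s k))" by (intro sum cont_s) auto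
    also have "\<dots> \<le> (\<Sum>k<n. ?m (S k))"
    proof (rule sum_mono)
      fix k
      have "ennreal (\<Lambda> (s k)) \<le> outer (S k)"
        using n by (intro le_outer_support cont_s) (auto simp: s_def S_def field_simps max_def min_def split: if_splits)
      also have "\<dots> = emeasure riesz_measure (S k)"
        by (rule emeasure_riesz_measure[symmetric]) (auto simp: S_borel, auto simp: S_def)
      finally show "\<Lambda> (s k) \<le> ?m (S k)"
        by (simp add: emeasure_eq_measure ennreal_le_iff)
    qed
    also have "\<dots> = (\<integral>x. (\<Sum>k<n. indicator (S k) x) \<partial>riesz_measure)"
      using S_sets by (subst Bochner_Integration.integral_sum) (auto simp: emeasure_eq_measure)
    also have "\<dots> \<le> (\<integral>x. n * f x + 1 \<partial>riesz_measure)"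
    proof (rule integral_mono)
      show "integrable riesz_measure (\<lambda>x. \<Sum>k<n. indicator (S k) x :: real)"
        using S_sets by (intro Bochner_Integration.integrable_sum) (auto simp: emeasure_eq_measure)
      show "integrable riesz_measure (\<lambda>x. n * f x + 1)"
        using integrable_riesz_measure[OF f(1)] by auto
      fix x assume "x \<in> space riesz_measure"
      then have x: "x \<in> K" by (simp add: space_riesz_measure)
      have "(\<Sum>k<N. indicator (S k) x :: real) \<le> N \<and> (\<Sum>k<N. indicator (S k) x) \<le> n * f x + 1" for N
      proof (induction N)
        case (Suc N)
        have "x \<in> S N \<longleftrightarrow> real N < n * f x" using x n by (simp add: S_def field_simps)
        then show ?case using Suc by (cases "x \<in> S N") auto
      qed (use f(2)[OF x] in simp)
      then show "(\<Sum>k<n. indicator (S k) x :: real) \<le> n * f x + 1" by blast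
    qed
    also have "\<dots> = n * (\<integral>x. f x \<partial>riesz_measure) + ?m K"
      using integrable_riesz_measure[OF f(1)] by (simp add: space_riesz_measure)
    finally show ?thesis using n by (simp add: field_simps)
  qed
  then have "\<forall>\<^sub>F n in sequentially. \<Lambda> f \<le> (\<integral>x. f x \<partial>riesz_measure) + ?m K / real n"
    using eventually_gt_at_top by (rule eventually_mono[rotated])
  moreover have "(\<lambda>n. (\<integral>x. f x \<partial>riesz_measure) + ?m K / real n) \<longlonglongrightarrow> (\<integral>x. f x \<partial>riesz_measure) + 0"
    by (intro tendsto_intros lim_const_over_n)
  ultimately show ?thesis using tendsto_lowerbound[of _ _ sequentially "\<Lambda> f"] by fastforce
qed

lemma measure_riesz_measure: "measure riesz_measure K = \<Lambda> (\<lambda>x. 1)"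
  using le_integral_unit_range[of "\<lambda>x. 1"] measure_riesz_measure_le
  by (simp add: space_riesz_measure)

text \<open>
  One inequality suffices because it can be applied to \<open>f\<close> and \<open>-f\<close>. An affine change of the values
  reduces it to functions with values in \<open>[0, 1]\<close>; this uses that the total mass is exactly \<open>\<Lambda> 1\<close>.
\<close>

theorem integral_riesz_measure:
  assumes f: "continuous_on K f"
  shows "(\<integral>x. f x \<partial>riesz_measure) = \<Lambda> f"
proof -
  interpret finite_measure riesz_measure by (rule finite_measure_riesz_measure)
  note int = integrable_riesz_measure
  have "bounded (f ` K)" using compact_continuous_image[OF f compact] by (rule compact_imp_bounded)
  then obtain B where B: "0 < B" "\<And>x. x \<in> K \<Longrightarrow> \<bar>f x\<bar> \<le> B" by (auto simp: bounded_pos)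
  have le: "\<Lambda> g \<le> (\<integral>x. g x \<partial>riesz_measure)"
    if g: "continuous_on K g" "\<And>x. x \<in> K \<Longrightarrow> \<bar>g x\<bar> \<le> B" for g
  proof -
    let ?u = "\<lambda>x. (1 / (2 * B)) * g x + 1 / 2"
    have g_le: "- B \<le> g x" "g x \<le> B" if "x \<in> K" for x using g(2)[OF that] by auto
    have u: "continuous_on K ?u" by (intro continuous_intros g)
    have "\<Lambda> ?u \<le> (\<integral>x. ?u x \<partial>riesz_measure)"
    proof (rule le_integral_unit_range[OF u])
      fix x assume "x \<in> K"
      from g_le[OF this] show "0 \<le> ?u x" "?u x \<le> 1" using B(1) by (auto simp: field_simps)
    qed
    moreover have "\<Lambda> ?u = (1 / (2 * B)) * \<Lambda> g + 1 / 2 * \<Lambda> (\<lambda>x. 1)"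
      using g(1) by (subst add) (auto simp only: scale const[of "1 / 2"] intro!: continuous_intros)
    moreover have "(\<integral>x. ?u x \<partial>riesz_measure) = (1 / (2 * B)) * (\<integral>x. g x \<partial>riesz_measure) + 1 / 2 * \<Lambda> (\<lambda>x. 1)"
      using int[OF g(1)] measure_riesz_measure by (simp add: space_riesz_measure)
    ultimately show ?thesis using B(1) by (simp add: field_simps)
  qed
  have "\<Lambda> f \<le> (\<integral>x. f x \<partial>riesz_measure)" using f B by (intro le) auto
  moreover have "\<Lambda> (\<lambda>x. - f x) \<le> (\<integral>x. - f x \<partial>riesz_measure)"
    using f B by (intro le continuous_intros) auto
  ultimately show ?thesis using minus[OF f] by simp
qed

end


text \<open>
  Tietze extension lets bounded continuous functions on the whole space, which form a real vector
  space as a type, stand for the continuous functions on a compact set.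
\<close>

lemma bounded_continuous_extension:
  fixes f :: "'d::{metric_space,second_countable_topology} \<Rightarrow> real"
  assumes "compact K" "continuous_on K f"
  obtains \<phi> :: "'d \<Rightarrow>\<^sub>C real" where "\<And>x. x \<in> K \<Longrightarrow> \<phi> x = f x"
proof -
  have "bounded (f ` K)" using assms by (intro compact_imp_bounded compact_continuous_image)
  then obtain B where B: "0 < B" "\<And>x. x \<in> K \<Longrightarrow> norm (f x) \<le> B" by (auto simp: bounded_pos)
  have "closedin (top_of_set UNIV) K" using assms(1) by (simp add: compact_imp_closed)
  from Tietze[OF assms(2) this _ B(2)] B(1)
  obtain g where g: "continuous_on UNIV g" "\<And>x. x \<in> K \<Longrightarrow> g x = f x" "\<And>x. norm (g x) \<le> B"
    by (metis UNIV_I less_imp_le)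
  then have "g \<in> bcontfun" by (intro bcontfun_normI)
  with g(2) that show thesis by (metis bcontfunE)
qed

text \<open>
  The sign condition makes \<open>\<Lambda> \<phi>\<close> depend only on the values of \<open>\<phi>\<close> on \<open>K\<close>, so \<open>\<Lambda>\<close> induces a positive
  functional on the continuous functions on \<open>K\<close>, independent of the choice of extensions.
\<close>

theorem Riesz_representation_bcontfun:
  fixes K :: "'d::{metric_space,second_countable_topology} set" and \<Lambda> :: "('d \<Rightarrow>\<^sub>C real) \<Rightarrow> real"
  assumes K: "compact K" and lin: "linear \<Lambda>"
    and nonpos: "\<And>\<phi> :: 'd \<Rightarrow>\<^sub>C real. (\<And>x. x \<in> K \<Longrightarrow> apply_bcontfun \<phi> x \<le> 0) \<Longrightarrow> \<Lambda> \<phi> \<le> 0"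
  obtains \<mu> where "\<mu> \<in> radon_measures K" "\<And>\<phi> :: 'd \<Rightarrow>\<^sub>C real. \<Lambda> \<phi> = (\<integral>x. apply_bcontfun \<phi> x \<partial>\<mu>)"
proof -
  define ext :: "('d \<Rightarrow> real) \<Rightarrow> 'd \<Rightarrow>\<^sub>C real" where "ext f = (SOME \<phi>. \<forall>x\<in>K. apply_bcontfun \<phi> x = f x)" for f
  have ext: "apply_bcontfun (ext f) x = f x" if "continuous_on K f" "x \<in> K" for f x
  proof -
    have "\<exists>\<phi> :: 'd \<Rightarrow>\<^sub>C real. \<forall>x\<in>K. apply_bcontfun \<phi> x = f x"
      using bounded_continuous_extension[OF K that(1)] by metis
    then have "\<forall>x\<in>K. apply_bcontfun (ext f) x = f x" unfolding ext_def by (rule someI_ex)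
    with that show ?thesis by blast
  qed
  have cong: "\<Lambda> \<phi> = \<Lambda> \<psi>" if "\<And>x. x \<in> K \<Longrightarrow> apply_bcontfun \<phi> x = apply_bcontfun \<psi> x" for \<phi> \<psi> :: "'d \<Rightarrow>\<^sub>C real"
    using nonpos[of "\<phi> - \<psi>"] nonpos[of "\<psi> - \<phi>"] that by (simp add: linear_diff[OF lin])
  interpret positive_functional K "\<lambda>f. \<Lambda> (ext f)"
  proof
    fix f g :: "'d \<Rightarrow> real" assume c: "continuous_on K f" "continuous_on K g"
    have "\<Lambda> (ext (\<lambda>x. f x + g x)) = \<Lambda> (ext f + ext g)"
      using c by (intro cong) (simp add: ext continuous_intros)
    then show "\<Lambda> (ext (\<lambda>x. f x + g x)) = \<Lambda> (ext f) + \<Lambda> (ext g)" by (simp add: linear_add[OF lin])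
  next
    fix a :: real and f :: "'d \<Rightarrow> real" assume c: "continuous_on K f"
    have "\<Lambda> (ext (\<lambda>x. a * f x)) = \<Lambda> (a *\<^sub>R ext f)"
      using c by (intro cong) (simp add: ext continuous_intros)
    then show "\<Lambda> (ext (\<lambda>x. a * f x)) = a * \<Lambda> (ext f)" by (simp add: linear_scale[OF lin])
  next
    fix f :: "'d \<Rightarrow> real" assume c: "continuous_on K f" "\<And>x. x \<in> K \<Longrightarrow> 0 \<le> f x"
    have "\<Lambda> (- ext f) \<le> 0" using c by (intro nonpos) (simp add: ext)
    then show "0 \<le> \<Lambda> (ext f)" by (simp add: linear_neg[OF lin])
  qed (rule K)
  have "\<Lambda> \<phi> = (\<integral>x. apply_bcontfun \<phi> x \<partial>riesz_measure)" for \<phi> :: "'d \<Rightarrow>\<^sub>C real"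
  proof -
    have "\<Lambda> \<phi> = \<Lambda> (ext (apply_bcontfun \<phi>))" by (intro cong) (simp add: ext)
    then show ?thesis by (simp add: integral_riesz_measure)
  qed
  with riesz_measure_radon show thesis by (rule that)
qed

section \<open>The augmented generator and weak duality\<close>

text \<open>
  Since \<open>L 1 = 0\<close> and \<open>L t = 1\<close>, functions that are affine in time are test functions with known constant
  image under the augmented generator. They supply the slack in the constraints of the function program.
\<close>

locale augmented_generator =
  fixes tm :: time_model and T h :: real and X X0 :: "'a::euclidean_space set"
    and C :: "(real \<times> 'a \<Rightarrow> real) set" and L :: "(real \<times> 'a \<Rightarrow> real) \<Rightarrow> real \<times> 'a \<Rightarrow> real"
  assumes h: "0 < h" "h \<le> T"
    and compact_X: "compact X" and compact_X0: "compact X0" and X0_subset: "X0 \<subseteq> X"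
    and linear_L: "linear_operator_on ({0..T} \<times> X) C L"
    and one: "(\<lambda>_. 1) \<in> C" "\<And>z. z \<in> {0..T} \<times> X \<Longrightarrow> L (\<lambda>_. 1) z = 0"
    and time: "(\<lambda>(t, x). t) \<in> C" "\<And>z. z \<in> {0..T} \<times> X \<Longrightarrow> L (\<lambda>(t, x). t) z = 1"
begin

abbreviation "D \<equiv> {h..T} \<times> {0..T} \<times> X"
abbreviation "Dom \<equiv> aug_dom T h X C L"
abbreviation "K0 \<equiv> {h..T} \<times> X0"
abbreviation "K\<tau> \<equiv> {h..T} \<times> X"
abbreviation "Kp \<equiv> supp_plus T h X"
abbreviation "Km \<equiv> supp_minus tm T h X"

lemma aug_dom_combination:
  assumes v: "v \<in> Dom" and w: "w \<in> Dom"
  shows "(\<lambda>z. a * v z + b * w z) \<in> Dom"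
    and "z \<in> D \<Longrightarrow> aug_gen L (\<lambda>z. a * v z + b * w z) z = a * aug_gen L v z + b * aug_gen L w z"
proof -
  have slice: "(\<lambda>(t, x). v (s, t, x)) \<in> C" "(\<lambda>(t, x). w (s, t, x)) \<in> C" if "s \<in> {h..T}" for s
    using v w that by (auto simp: aug_dom_def)
  have eq: "(\<lambda>(t, x). a * v (s, t, x) + b * w (s, t, x)) =
     (\<lambda>z. a * (\<lambda>(t, x). v (s, t, x)) z + b * (\<lambda>(t, x). w (s, t, x)) z)" for s
    by auto
  have comb: "(\<lambda>(t, x). a * v (s, t, x) + b * w (s, t, x)) \<in> C"
    "\<And>z. z \<in> {0..T} \<times> X \<Longrightarrow> L (\<lambda>(t, x). a * v (s, t, x) + b * w (s, t, x)) z =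
      a * L (\<lambda>(t, x). v (s, t, x)) z + b * L (\<lambda>(t, x). w (s, t, x)) z" if "s \<in> {h..T}" for s
    using linear_L slice[OF that] unfolding eq linear_operator_on_def by blast+
  have gen: "aug_gen L (\<lambda>z. a * v z + b * w z) z = a * aug_gen L v z + b * aug_gen L w z" if "z \<in> D" for z
    using that comb(2) by (auto simp: aug_gen_def)
  have "continuous_on D (\<lambda>z. a * aug_gen L v z + b * aug_gen L w z)"
    using v w by (intro continuous_intros) (auto simp: aug_dom_def)
  then have "continuous_on D (aug_gen L (\<lambda>z. a * v z + b * w z))"
    by (subst continuous_on_cong[OF refl gen])
  moreover have "continuous_on D (\<lambda>z. a * v z + b * w z)"
    using v w by (intro continuous_intros) (auto simp: aug_dom_def)
  ultimately show "(\<lambda>z. a * v z + b * w z) \<in> Dom"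
    using comb(1) by (auto simp: aug_dom_def)
  show "z \<in> D \<Longrightarrow> aug_gen L (\<lambda>z. a * v z + b * w z) z = a * aug_gen L v z + b * aug_gen L w z"
    by (rule gen)
qed

lemma aug_affine_time:
  shows "(\<lambda>(s, t, x). a + b * t) \<in> Dom"
    and "z \<in> D \<Longrightarrow> aug_gen L (\<lambda>(s, t, x). a + b * t) z = b"
proof -
  have gen1: "aug_gen L (\<lambda>_. 1) z = 0" if "z \<in> D" for z
    using that one(2) by (auto simp: aug_gen_def case_prod_unfold)
  have "continuous_on D (aug_gen L (\<lambda>_. 1))"
    by (subst continuous_on_cong[OF refl gen1]) auto
  then have const_dom: "(\<lambda>_. 1) \<in> Dom" using one(1) by (auto simp: aug_dom_def case_prod_unfold)
  have gent: "aug_gen L (\<lambda>(s, t, x). t) z = 1" if "z \<in> D" for z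
    using that time(2) by (auto simp: aug_gen_def)
  have "continuous_on D (aug_gen L (\<lambda>(s, t, x). t))"
    by (subst continuous_on_cong[OF refl gent]) auto
  then have time_dom: "(\<lambda>(s, t, x). t) \<in> Dom" using time(1)
    by (auto simp: aug_dom_def case_prod_unfold intro!: continuous_intros)
  have eq: "(\<lambda>(s, t, x). a + b * t) = (\<lambda>z. a * 1 + b * (\<lambda>(s, t, x). t) z)" by (auto simp: fun_eq_iff)
  show "(\<lambda>(s, t, x). a + b * t) \<in> Dom" unfolding eq by (rule aug_dom_combination[OF const_dom time_dom])
  show "aug_gen L (\<lambda>(s, t, x). a + b * t) z = b" if "z \<in> D"
    unfolding eq using aug_dom_combination(2)[OF const_dom time_dom that, of a b] gen1[OF that] gent[OF that] by simp
qed

lemma supports_subset: "Kp \<subseteq> D" "Km \<subseteq> D"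
proof -
  show "Kp \<subseteq> D" by (auto simp: supp_plus_def)
  show "Km \<subseteq> D" by (cases tm) auto
qed

lemma compact_D: "compact D"
  by (intro compact_Times compact_Icc compact_X)

lemma compact_supports: "compact K0" "compact K\<tau>" "compact Kp" "compact Km"
proof -
  show "compact K0" "compact K\<tau>" using compact_X compact_X0 by (auto intro!: compact_Times)
  have closed: "closed {z :: real \<times> real \<times> 'a. f z \<le> g z}"
    if "continuous_on UNIV f" "continuous_on UNIV g" for f g :: "real \<times> real \<times> 'a \<Rightarrow> real"
    by (rule closed_Collect_le[OF that])
  have "Kp = D \<inter> {z. fst z - h \<le> fst (snd z)} \<inter> {z. fst (snd z) \<le> fst z}"
    by (auto simp: supp_plus_def)
  then show "compact Kp"
    by (auto intro!: compact_Int_closed compact_D closed continuous_intros)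
  have "Km = D \<inter> {z. fst (snd z) \<le> fst z - h - (case tm of Continuous_Time \<Rightarrow> 0 | Discrete_Time dt \<Rightarrow> dt)}"
    by (cases tm) auto
  then show "compact Km"
    by (auto intro!: compact_Int_closed compact_D closed continuous_intros)
qed

lemma continuous_on_supports:
  assumes "v \<in> Dom"
  shows "continuous_on K0 (\<lambda>(s, x). v (s, 0, x))" "continuous_on K\<tau> (\<lambda>(s, x). v (s, s, x))"
    "continuous_on Kp (aug_gen L v)" "continuous_on Km (aug_gen L v)"
proof -
  have v: "continuous_on D v" and Lv: "continuous_on D (aug_gen L v)"
    using assms by (auto simp: aug_dom_def)
  show "continuous_on K0 (\<lambda>(s, x). v (s, 0, x))"
    unfolding case_prod_unfold
    by (rule continuous_on_compose2[OF v]) (use h X0_subset in \<open>auto intro!: continuous_intros\<close>)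
  show "continuous_on K\<tau> (\<lambda>(s, x). v (s, s, x))"
    unfolding case_prod_unfold
    by (rule continuous_on_compose2[OF v]) (use h in \<open>auto intro!: continuous_intros\<close>)
  show "continuous_on Kp (aug_gen L v)" "continuous_on Km (aug_gen L v)"
    using continuous_on_subset[OF Lv] supports_subset by auto
qed

text \<open>
  Integrate the constraint of the function program on each support against the measure there, and
  cancel the terms in \<open>v\<close> with the Liouville equation.
\<close>

lemma weak_duality:
  assumes p: "continuous_on X p"
    and m: "m \<in> measure_feasible tm T h X X0 C L"
    and f: "(v, \<gamma>, \<xi>) \<in> function_feasible tm T h X X0 p C L"
  shows "measure_objective h p m \<le> \<gamma> + h * \<xi>"
proof -
  obtain \<mu>0 \<mu>\<tau> \<mu>p \<mu>m where meq: "m = (\<mu>0, \<mu>\<tau>, \<mu>p, \<mu>m)" by (cases m)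
  have radon: "\<mu>0 \<in> radon_measures K0" "\<mu>\<tau> \<in> radon_measures K\<tau>" "\<mu>p \<in> radon_measures Kp" "\<mu>m \<in> radon_measures Km"
    and mass: "(\<integral>z. 1 \<partial>\<mu>0) = (1::real)" "(\<integral>z. 1 \<partial>\<mu>p) = h"
    and liou: "\<And>v. v \<in> Dom \<Longrightarrow> (\<integral>(s, x). v (s, s, x) \<partial>\<mu>\<tau>) =
           (\<integral>(s, x). v (s, 0, x) \<partial>\<mu>0) + ((\<integral>z. aug_gen L v z \<partial>\<mu>m) + (\<integral>z. aug_gen L v z \<partial>\<mu>p))"
    using m by (auto simp: measure_feasible_def meq)
  have v: "v \<in> Dom" and
    c0: "\<And>s x. (s, x) \<in> K0 \<Longrightarrow> v (s, 0, x) \<le> \<gamma>" and c\<tau>: "\<And>s x. (s, x) \<in> K\<tau> \<Longrightarrow> 0 \<le> v (s, s, x)" and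
    cp: "\<And>s t x. (s, t, x) \<in> Kp \<Longrightarrow> aug_gen L v (s, t, x) + p x / h \<le> \<xi>" and
    cm: "\<And>s t x. (s, t, x) \<in> Km \<Longrightarrow> aug_gen L v (s, t, x) \<le> 0"
    using f by (auto simp: function_feasible_def)
  note cont = continuous_on_supports[OF v]
  note sp = radon_measures_space[OF radon(1)] radon_measures_space[OF radon(2)]
    radon_measures_space[OF radon(3)] radon_measures_space[OF radon(4)]
  note int = radon_measures_integrable[OF compact_supports(1) radon(1)]
    radon_measures_integrable[OF compact_supports(2) radon(2)]
    radon_measures_integrable[OF compact_supports(3) radon(3)]
    radon_measures_integrable[OF compact_supports(4) radon(4)]
  have p': "continuous_on Kp (\<lambda>(s, t, x). p x)"
    unfolding case_prod_unfold
    by (rule continuous_on_compose2[OF p]) (auto intro!: continuous_intros simp: supp_plus_def)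
  have const: "integrable \<mu>0 (\<lambda>z. c)" "integrable \<mu>p (\<lambda>z. c)" for c :: real
    by (rule int; simp)+
  have "(\<integral>(s, t, x). p x \<partial>\<mu>p) / h = (\<integral>z. (\<lambda>(s, t, x). p x) z / h \<partial>\<mu>p)" by simp
  also have "\<dots> \<le> (\<integral>z. \<xi> - aug_gen L v z \<partial>\<mu>p)"
  proof (rule integral_mono)
    fix z assume "z \<in> space \<mu>p"
    then show "(\<lambda>(s, t, x). p x) z / h \<le> \<xi> - aug_gen L v z"
      using cp sp(3) by (cases z) (auto simp: le_diff_eq add.commute)
  qed (intro integrable_divide_zero Bochner_Integration.integrable_diff const int cont p')+
  also have "\<dots> = h * \<xi> - (\<integral>z. aug_gen L v z \<partial>\<mu>p)"
    using mass(2) int(3)[OF cont(3)] const(2) by (subst Bochner_Integration.integral_diff) auto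
  finally have 1: "measure_objective h p m \<le> h * \<xi> - (\<integral>z. aug_gen L v z \<partial>\<mu>p)"
    by (simp add: measure_objective_def meq)
  have "(\<integral>z. (\<lambda>(s, x). v (s, 0, x)) z \<partial>\<mu>0) \<le> (\<integral>z. \<gamma> \<partial>\<mu>0)"
  proof (rule integral_mono)
    fix z assume "z \<in> space \<mu>0"
    then show "(\<lambda>(s, x). v (s, 0, x)) z \<le> \<gamma>" using c0 sp(1) by (cases z) auto
  qed (intro const int cont)+
  then have 2: "(\<integral>(s, x). v (s, 0, x) \<partial>\<mu>0) \<le> \<gamma>" using mass(1) by simp
  have 3: "0 \<le> (\<integral>(s, x). v (s, s, x) \<partial>\<mu>\<tau>)"
    using c\<tau> sp(2) by (intro Bochner_Integration.integral_nonneg) auto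
  have "0 \<le> (\<integral>z. - aug_gen L v z \<partial>\<mu>m)"
    using cm sp(4) by (intro Bochner_Integration.integral_nonneg) auto
  then have 4: "(\<integral>z. aug_gen L v z \<partial>\<mu>m) \<le> 0" by simp
  from 1 2 3 4 liou[OF v] show ?thesis by linarith
qed

section \<open>Strong duality\<close>

text \<open>
  The signs of the perturbations are chosen such that increasing any of the four components
  shrinks the feasible set. Every functional below the cone is then positive in each component.
\<close>

definition perturbed_dual ::
  "((((real \<times> 'a) \<Rightarrow>\<^sub>C real) \<times> ((real \<times> 'a) \<Rightarrow>\<^sub>C real) \<times>
     ((real \<times> real \<times> 'a) \<Rightarrow>\<^sub>C real) \<times> ((real \<times> real \<times> 'a) \<Rightarrow>\<^sub>C real)) \<times> real) set" where
  "perturbed_dual = {((\<phi>0, \<phi>\<tau>, \<phi>p, \<phi>m), r). \<exists>v\<in>Dom. \<exists>\<gamma> \<xi>. r = \<gamma> + h * \<xi> \<and>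
     (\<forall>s\<in>{h..T}. \<forall>x\<in>X0. v (s, 0, x) + apply_bcontfun \<phi>0 (s, x) \<le> \<gamma>) \<and>
     (\<forall>s\<in>{h..T}. \<forall>x\<in>X. apply_bcontfun \<phi>\<tau> (s, x) \<le> v (s, s, x)) \<and>
     (\<forall>z\<in>Kp. aug_gen L v z + apply_bcontfun \<phi>p z \<le> \<xi>) \<and> (\<forall>z\<in>Km. aug_gen L v z + apply_bcontfun \<phi>m z \<le> 0)}"

lemma perturbed_dualI:
  assumes "v \<in> Dom" "r = \<gamma> + h * \<xi>"
    "\<And>s x. s \<in> {h..T} \<Longrightarrow> x \<in> X0 \<Longrightarrow> v (s, 0, x) + apply_bcontfun \<phi>0 (s, x) \<le> \<gamma>"
    "\<And>s x. s \<in> {h..T} \<Longrightarrow> x \<in> X \<Longrightarrow> apply_bcontfun \<phi>\<tau> (s, x) \<le> v (s, s, x)"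
    "\<And>z. z \<in> Kp \<Longrightarrow> aug_gen L v z + apply_bcontfun \<phi>p z \<le> \<xi>"
    "\<And>z. z \<in> Km \<Longrightarrow> aug_gen L v z + apply_bcontfun \<phi>m z \<le> 0"
  shows "((\<phi>0, \<phi>\<tau>, \<phi>p, \<phi>m), r) \<in> perturbed_dual"
  using assms unfolding perturbed_dual_def by blast

lemma perturbed_dualE:
  assumes "((\<phi>0, \<phi>\<tau>, \<phi>p, \<phi>m), r) \<in> perturbed_dual"
  obtains v \<gamma> \<xi> where "v \<in> Dom" "r = \<gamma> + h * \<xi>"
    "\<And>s x. s \<in> {h..T} \<Longrightarrow> x \<in> X0 \<Longrightarrow> v (s, 0, x) + apply_bcontfun \<phi>0 (s, x) \<le> \<gamma>"
    "\<And>s x. s \<in> {h..T} \<Longrightarrow> x \<in> X \<Longrightarrow> apply_bcontfun \<phi>\<tau> (s, x) \<le> v (s, s, x)"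
    "\<And>z. z \<in> Kp \<Longrightarrow> aug_gen L v z + apply_bcontfun \<phi>p z \<le> \<xi>"
    "\<And>z. z \<in> Km \<Longrightarrow> aug_gen L v z + apply_bcontfun \<phi>m z \<le> 0"
  using assms unfolding perturbed_dual_def by blast

lemma perturbed_dual_comb:
  assumes "(e, r) \<in> perturbed_dual" "(e', r') \<in> perturbed_dual" and ab: "0 \<le> a" "0 \<le> b"
  shows "(a *\<^sub>R e + b *\<^sub>R e', a * r + b * r') \<in> perturbed_dual"
proof -
  obtain \<phi>0 \<phi>\<tau> \<phi>p \<phi>m \<psi>0 \<psi>\<tau> \<psi>p \<psi>m where e: "e = (\<phi>0, \<phi>\<tau>, \<phi>p, \<phi>m)" "e' = (\<psi>0, \<psi>\<tau>, \<psi>p, \<psi>m)"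
    by (cases e, cases e')
  obtain v \<gamma> \<xi> where v: "v \<in> Dom" "r = \<gamma> + h * \<xi>"
    "\<And>s x. s \<in> {h..T} \<Longrightarrow> x \<in> X0 \<Longrightarrow> v (s, 0, x) + apply_bcontfun \<phi>0 (s, x) \<le> \<gamma>"
    "\<And>s x. s \<in> {h..T} \<Longrightarrow> x \<in> X \<Longrightarrow> apply_bcontfun \<phi>\<tau> (s, x) \<le> v (s, s, x)"
    "\<And>z. z \<in> Kp \<Longrightarrow> aug_gen L v z + apply_bcontfun \<phi>p z \<le> \<xi>"
    "\<And>z. z \<in> Km \<Longrightarrow> aug_gen L v z + apply_bcontfun \<phi>m z \<le> 0"
    using perturbed_dualE assms(1)[unfolded e] by blast
  obtain w \<gamma>' \<xi>' where w: "w \<in> Dom" "r' = \<gamma>' + h * \<xi>'"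
    "\<And>s x. s \<in> {h..T} \<Longrightarrow> x \<in> X0 \<Longrightarrow> w (s, 0, x) + apply_bcontfun \<psi>0 (s, x) \<le> \<gamma>'"
    "\<And>s x. s \<in> {h..T} \<Longrightarrow> x \<in> X \<Longrightarrow> apply_bcontfun \<psi>\<tau> (s, x) \<le> w (s, s, x)"
    "\<And>z. z \<in> Kp \<Longrightarrow> aug_gen L w z + apply_bcontfun \<psi>p z \<le> \<xi>'"
    "\<And>z. z \<in> Km \<Longrightarrow> aug_gen L w z + apply_bcontfun \<psi>m z \<le> 0"
    using perturbed_dualE assms(2)[unfolded e] by blast
  have comb: "a * i + b * j \<le> a * k + b * l" if "i \<le> k" "j \<le> l" for i j k l
    using ab that by (intro add_mono mult_left_mono)
  have comb': "(a * i + b * j) + (a * i' + b * j') \<le> a * k + b * l" if "i + i' \<le> k" "j + j' \<le> l" for i j i' j' k l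
    using comb[OF that] by (simp add: algebra_simps)
  have gen: "aug_gen L (\<lambda>z. a * v z + b * w z) z = a * aug_gen L v z + b * aug_gen L w z"
    if "z \<in> Kp \<or> z \<in> Km" for z
    by (rule aug_dom_combination(2)[OF v(1) w(1)]) (use that supports_subset in blast)
  have "((a *\<^sub>R \<phi>0 + b *\<^sub>R \<psi>0, a *\<^sub>R \<phi>\<tau> + b *\<^sub>R \<psi>\<tau>, a *\<^sub>R \<phi>p + b *\<^sub>R \<psi>p, a *\<^sub>R \<phi>m + b *\<^sub>R \<psi>m),
      a * r + b * r') \<in> perturbed_dual"
  proof (rule perturbed_dualI[OF aug_dom_combination(1)[OF v(1) w(1), of a b]])
    show "a * r + b * r' = (a * \<gamma> + b * \<gamma>') + h * (a * \<xi> + b * \<xi>')"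
      by (simp add: v(2) w(2) algebra_simps)
  next
    fix s x assume "s \<in> {h..T}" "x \<in> X0"
    from comb'[OF v(3)[OF this] w(3)[OF this]]
    show "(a * v (s, 0, x) + b * w (s, 0, x)) + apply_bcontfun (a *\<^sub>R \<phi>0 + b *\<^sub>R \<psi>0) (s, x)
        \<le> a * \<gamma> + b * \<gamma>'" by simp
  next
    fix s x assume "s \<in> {h..T}" "x \<in> X"
    from comb[OF v(4)[OF this] w(4)[OF this]]
    show "apply_bcontfun (a *\<^sub>R \<phi>\<tau> + b *\<^sub>R \<psi>\<tau>) (s, x) \<le> a * v (s, s, x) + b * w (s, s, x)" by simp
  next
    fix z assume z: "z \<in> Kp"
    from comb'[OF v(5)[OF z] w(5)[OF z]] gen[of z] z
    show "aug_gen L (\<lambda>z. a * v z + b * w z) z + apply_bcontfun (a *\<^sub>R \<phi>p + b *\<^sub>R \<psi>p) z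
        \<le> a * \<xi> + b * \<xi>'" by simp
  next
    fix z assume z: "z \<in> Km"
    from comb'[OF v(6)[OF z] w(6)[OF z]] gen[of z] z
    show "aug_gen L (\<lambda>z. a * v z + b * w z) z + apply_bcontfun (a *\<^sub>R \<phi>m + b *\<^sub>R \<psi>m) z \<le> 0"
      by simp
  qed
  then show ?thesis by (simp add: e)
qed

text \<open>
  The function \<open>v = B\<^sub>\<tau> + B\<^sub>m * (T - t)\<close> has image \<open>- B\<^sub>m\<close> under the augmented generator and is at least
  \<open>B\<^sub>\<tau>\<close>; with \<open>B\<^sub>\<tau>\<close> and \<open>B\<^sub>m\<close> bounding the perturbations this satisfies the constraints without a free
  constant, and \<open>\<gamma>\<close> and \<open>\<xi>\<close> take care of the other two.
\<close>

lemma perturbed_dual_total: "\<exists>r. (e, r) \<in> perturbed_dual"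
proof -
  obtain \<phi>0 \<phi>\<tau> \<phi>p \<phi>m where e: "e = (\<phi>0, \<phi>\<tau>, \<phi>p, \<phi>m)" by (cases e)
  have bound: "\<exists>B\<ge>0. \<forall>x. \<phi> x \<le> B" for \<phi> :: "'z::topological_space \<Rightarrow>\<^sub>C real"
  proof -
    obtain B where "0 < B" "\<And>x. \<bar>\<phi> x\<bar> \<le> B"
      using bounded_apply_bcontfun[of \<phi>] by (auto simp: bounded_pos)
    then show ?thesis by (intro exI[of _ B]) (auto simp: abs_le_iff)
  qed
  obtain B0 B\<tau> Bp Bm where B: "\<And>z. apply_bcontfun \<phi>0 z \<le> B0" "\<And>z. apply_bcontfun \<phi>\<tau> z \<le> B\<tau>" "\<And>z. apply_bcontfun \<phi>p z \<le> Bp" "\<And>z. apply_bcontfun \<phi>m z \<le> Bm" "0 \<le> Bm"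
    using bound[of \<phi>0] bound[of \<phi>\<tau>] bound[of \<phi>p] bound[of \<phi>m] by auto
  define v where "v = (\<lambda>(s :: real, t :: real, x :: 'a). (B\<tau> + Bm * T) + (- Bm) * t)"
  have v: "v \<in> Dom" unfolding v_def by (rule aug_affine_time(1))
  have gen: "aug_gen L v z = - Bm" if "z \<in> Kp \<or> z \<in> Km" for z
    unfolding v_def by (rule aug_affine_time(2)) (use that supports_subset in auto)
  have "(e, (B\<tau> + Bm * T + B0) + h * (Bp - Bm)) \<in> perturbed_dual"
    unfolding e
  proof (rule perturbed_dualI[OF v refl])
    fix s x assume "s \<in> {h..T}" "x \<in> X"
    then have "Bm * s \<le> Bm * T" using B(5) by (intro mult_left_mono) auto
    then show "apply_bcontfun \<phi>\<tau> (s, x) \<le> v (s, s, x)" using B(2)[of "(s, x)"] by (simp add: v_def)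
  next
    fix z assume "z \<in> Kp" then show "aug_gen L v z + apply_bcontfun \<phi>p z \<le> Bp - Bm" using B(3)[of z] by (simp add: gen)
  next
    fix z assume "z \<in> Km" then show "aug_gen L v z + apply_bcontfun \<phi>m z \<le> 0" using B(4)[of z] by (simp add: gen)
  qed (use B(1) in \<open>auto simp: v_def\<close>)
  then show ?thesis ..
qed

lemma d_star_eq_INF:
  fixes \<pi> :: "(real \<times> real \<times> 'a) \<Rightarrow>\<^sub>C real"
  assumes \<pi>: "\<And>s t x. (s, t, x) \<in> Kp \<Longrightarrow> apply_bcontfun \<pi> (s, t, x) = p x / h"
  shows "d_star tm T h X X0 p C L = (INF r\<in>{r. ((0, 0, \<pi>, 0), r) \<in> perturbed_dual}. ereal r)"
proof -
  have "(\<lambda>(v, \<gamma>, \<xi>). ereal (\<gamma> + h * \<xi>)) ` function_feasible tm T h X X0 p C L =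
    ereal ` {r. ((0, 0, \<pi>, 0), r) \<in> perturbed_dual}"
  proof (intro equalityI subsetI)
    fix y assume "y \<in> (\<lambda>(v, \<gamma>, \<xi>). ereal (\<gamma> + h * \<xi>)) ` function_feasible tm T h X X0 p C L"
    then obtain v \<gamma> \<xi> where y: "y = ereal (\<gamma> + h * \<xi>)" and f: "(v, \<gamma>, \<xi>) \<in> function_feasible tm T h X X0 p C L"
      by auto
    have "((0, 0, \<pi>, 0), \<gamma> + h * \<xi>) \<in> perturbed_dual"
      using f \<pi> by (intro perturbed_dualI[of v]) (auto simp: function_feasible_def)
    with y show "y \<in> ereal ` {r. ((0, 0, \<pi>, 0), r) \<in> perturbed_dual}" by blast
  next
    fix y assume "y \<in> ereal ` {r. ((0, 0, \<pi>, 0), r) \<in> perturbed_dual}"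
    then obtain r where r: "y = ereal r" "((0, 0, \<pi>, 0), r) \<in> perturbed_dual" by auto
    from r(2) obtain v \<gamma> \<xi> where v: "v \<in> Dom" "r = \<gamma> + h * \<xi>"
      "\<And>s x. s \<in> {h..T} \<Longrightarrow> x \<in> X0 \<Longrightarrow> v (s, 0, x) + apply_bcontfun (0 :: (real \<times> 'a) \<Rightarrow>\<^sub>C real) (s, x) \<le> \<gamma>"
      "\<And>s x. s \<in> {h..T} \<Longrightarrow> x \<in> X \<Longrightarrow> apply_bcontfun (0 :: (real \<times> 'a) \<Rightarrow>\<^sub>C real) (s, x) \<le> v (s, s, x)"
      "\<And>z. z \<in> Kp \<Longrightarrow> aug_gen L v z + apply_bcontfun \<pi> z \<le> \<xi>"
      "\<And>z. z \<in> Km \<Longrightarrow> aug_gen L v z + apply_bcontfun (0 :: (real \<times> real \<times> 'a) \<Rightarrow>\<^sub>C real) z \<le> 0"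
      by (rule perturbed_dualE) blast
    have "(v, \<gamma>, \<xi>) \<in> function_feasible tm T h X X0 p C L"
      using v(1,3,4,6) v(5)[unfolded split_paired_all] \<pi> by (fastforce simp: function_feasible_def)
    then show "y \<in> (\<lambda>(v, \<gamma>, \<xi>). ereal (\<gamma> + h * \<xi>)) ` function_feasible tm T h X X0 p C L"
      using r(1) v(2) by force
  qed
  then show ?thesis by (simp add: d_star_def)
qed

text \<open>
  A constant perturbation \<open>c\<close> of the first or third constraint is absorbed by \<open>\<gamma> = c\<close> or \<open>\<xi> = c\<close>, at
  cost \<open>c\<close> or \<open>h * c\<close>; both signs of \<open>c\<close> fix the masses of \<open>\<mu>0\<close> and \<open>\<mu>p\<close>. The perturbation that makes
  the constraints on a given \<open>v\<close> tight has cost \<open>0\<close>; using \<open>v\<close> and \<open>-v\<close> gives the Liouville equation.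
\<close>

lemma measures_of_functional:
  assumes lin: "linear \<Lambda>" and le: "\<And>e r. (e, r) \<in> perturbed_dual \<Longrightarrow> \<Lambda> e \<le> r"
  obtains \<mu>0 \<mu>\<tau> \<mu>p \<mu>m where "(\<mu>0, \<mu>\<tau>, \<mu>p, \<mu>m) \<in> measure_feasible tm T h X X0 C L"
    "\<And>\<phi> :: (real \<times> real \<times> 'a) \<Rightarrow>\<^sub>C real. \<Lambda> (0, 0, \<phi>, 0) = (\<integral>z. apply_bcontfun \<phi> z \<partial>\<mu>p)"
proof -
  define zero where "zero = (\<lambda>(s :: real, t :: real, x :: 'a). 0 + 0 * t)"
  have zero: "zero \<in> Dom" "\<And>z. z \<in> D \<Longrightarrow> aug_gen L zero z = 0" "\<And>z. zero z = 0"
    unfolding zero_def by (rule aug_affine_time, rule aug_affine_time(2), auto)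
  note zeroI = perturbed_dualI[OF zero(1)]
  have lin': "linear (\<lambda>\<phi>. \<Lambda> (\<phi>, 0, 0, 0))" "linear (\<lambda>\<phi>. \<Lambda> (0, \<phi>, 0, 0))"
    "linear (\<lambda>\<phi>. \<Lambda> (0, 0, \<phi>, 0))" "linear (\<lambda>\<phi>. \<Lambda> (0, 0, 0, \<phi>))"
    by (rule linear_compose[OF _ lin, unfolded o_def], rule linearI; simp)+
  have gz: "aug_gen L zero z = 0" if "z \<in> Kp \<or> z \<in> Km" for z
    using that supports_subset zero(2) by blast
  \<comment> \<open>A nonpositive perturbation admits \<open>v = 0\<close>, \<open>\<gamma> = 0\<close>, \<open>\<xi> = 0\<close>, so \<open>\<Lambda>\<close> has the sign that Riesz needs.\<close>
  obtain \<mu>0 where \<mu>0: "\<mu>0 \<in> radon_measures K0" "\<And>\<phi> :: (real \<times> 'a) \<Rightarrow>\<^sub>C real. \<Lambda> (\<phi>, 0, 0, 0) = (\<integral>z. apply_bcontfun \<phi> z \<partial>\<mu>0)"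
    by (rule Riesz_representation_bcontfun[OF compact_supports(1) lin'(1)])
       (rule le, rule zeroI[where \<gamma> = 0 and \<xi> = 0], auto simp: gz zero(3))
  obtain \<mu>\<tau> where \<mu>\<tau>: "\<mu>\<tau> \<in> radon_measures K\<tau>" "\<And>\<phi> :: (real \<times> 'a) \<Rightarrow>\<^sub>C real. \<Lambda> (0, \<phi>, 0, 0) = (\<integral>z. apply_bcontfun \<phi> z \<partial>\<mu>\<tau>)"
    by (rule Riesz_representation_bcontfun[OF compact_supports(2) lin'(2)])
       (rule le, rule zeroI[where \<gamma> = 0 and \<xi> = 0], auto simp: gz zero(3))
  obtain \<mu>p where \<mu>p: "\<mu>p \<in> radon_measures Kp" "\<And>\<phi> :: (real \<times> real \<times> 'a) \<Rightarrow>\<^sub>C real. \<Lambda> (0, 0, \<phi>, 0) = (\<integral>z. apply_bcontfun \<phi> z \<partial>\<mu>p)"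
    by (rule Riesz_representation_bcontfun[OF compact_supports(3) lin'(3)])
       (rule le, rule zeroI[where \<gamma> = 0 and \<xi> = 0], auto simp: gz zero(3))
  obtain \<mu>m where \<mu>m: "\<mu>m \<in> radon_measures Km" "\<And>\<phi> :: (real \<times> real \<times> 'a) \<Rightarrow>\<^sub>C real. \<Lambda> (0, 0, 0, \<phi>) = (\<integral>z. apply_bcontfun \<phi> z \<partial>\<mu>m)"
    by (rule Riesz_representation_bcontfun[OF compact_supports(4) lin'(4)])
       (rule le, rule zeroI[where \<gamma> = 0 and \<xi> = 0], auto simp: gz zero(3))
  have split: "\<Lambda> (\<phi>0, \<phi>\<tau>, \<phi>p, \<phi>m) = (\<integral>z. apply_bcontfun \<phi>0 z \<partial>\<mu>0) + (\<integral>z. apply_bcontfun \<phi>\<tau> z \<partial>\<mu>\<tau>) + (\<integral>z. apply_bcontfun \<phi>p z \<partial>\<mu>p) + (\<integral>z. apply_bcontfun \<phi>m z \<partial>\<mu>m)"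
    for \<phi>0 \<phi>\<tau> :: "(real \<times> 'a) \<Rightarrow>\<^sub>C real" and \<phi>p \<phi>m :: "(real \<times> real \<times> 'a) \<Rightarrow>\<^sub>C real"
  proof -
    have "(\<phi>0, \<phi>\<tau>, \<phi>p, \<phi>m) = (\<phi>0, 0, 0, 0) + (0, \<phi>\<tau>, 0, 0) + (0, 0, \<phi>p, 0) + (0, 0, 0, \<phi>m)" by simp
    then show ?thesis by (simp only: linear_add[OF lin] \<mu>0(2) \<mu>\<tau>(2) \<mu>p(2) \<mu>m(2))
  qed
  have mass0: "(\<integral>z. 1 \<partial>\<mu>0) = (1::real)"
  proof -
    have "(\<integral>z. 1 \<partial>\<mu>0) * c \<le> c" for c :: real
    proof -
      have "\<Lambda> (const_bcontfun c, 0, 0, 0) \<le> c"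
        by (rule le, rule zeroI[where \<gamma> = c and \<xi> = 0]) (auto simp: gz zero(3) const_bcontfun.rep_eq)
      then show ?thesis by (simp add: \<mu>0(2) const_bcontfun.rep_eq)
    qed
    from this[of 1] this[of "-1"] show ?thesis by simp
  qed
  have massp: "(\<integral>z. 1 \<partial>\<mu>p) = h"
  proof -
    have "(\<integral>z. 1 \<partial>\<mu>p) * c \<le> h * c" for c :: real
    proof -
      have "\<Lambda> (0, 0, const_bcontfun c, 0) \<le> h * c"
        by (rule le, rule zeroI[where \<gamma> = 0 and \<xi> = c]) (auto simp: gz zero(3) const_bcontfun.rep_eq)
      then show ?thesis by (simp add: \<mu>p(2) const_bcontfun.rep_eq)
    qed
    from this[of 1] this[of "-1"] show ?thesis by simp
  qed
  note sp = radon_measures_space[OF \<mu>0(1)] radon_measures_space[OF \<mu>\<tau>(1)]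
    radon_measures_space[OF \<mu>p(1)] radon_measures_space[OF \<mu>m(1)]
  have ineq: "(\<integral>(s, x). v (s, s, x) \<partial>\<mu>\<tau>) \<le> (\<integral>(s, x). v (s, 0, x) \<partial>\<mu>0) +
      ((\<integral>z. aug_gen L v z \<partial>\<mu>m) + (\<integral>z. aug_gen L v z \<partial>\<mu>p))" if v: "v \<in> Dom" for v
  proof -
    note cont = continuous_on_supports[OF v]
    obtain \<phi>0 :: "(real \<times> 'a) \<Rightarrow>\<^sub>C real" where \<phi>0: "\<And>z. z \<in> K0 \<Longrightarrow> apply_bcontfun \<phi>0 z = - (\<lambda>(s, x). v (s, 0, x)) z"
      using bounded_continuous_extension[OF compact_supports(1) continuous_on_minus[OF cont(1)]] by blast
    obtain \<phi>\<tau> :: "(real \<times> 'a) \<Rightarrow>\<^sub>C real" where \<phi>\<tau>: "\<And>z. z \<in> K\<tau> \<Longrightarrow> apply_bcontfun \<phi>\<tau> z = (\<lambda>(s, x). v (s, s, x)) z"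
      using bounded_continuous_extension[OF compact_supports(2) cont(2)] by blast
    obtain \<phi>p :: "(real \<times> real \<times> 'a) \<Rightarrow>\<^sub>C real" where \<phi>p: "\<And>z. z \<in> Kp \<Longrightarrow> apply_bcontfun \<phi>p z = - aug_gen L v z"
      using bounded_continuous_extension[OF compact_supports(3) continuous_on_minus[OF cont(3)]] by blast
    obtain \<phi>m :: "(real \<times> real \<times> 'a) \<Rightarrow>\<^sub>C real" where \<phi>m: "\<And>z. z \<in> Km \<Longrightarrow> apply_bcontfun \<phi>m z = - aug_gen L v z"
      using bounded_continuous_extension[OF compact_supports(4) continuous_on_minus[OF cont(4)]] by blast
    have "((\<phi>0, \<phi>\<tau>, \<phi>p, \<phi>m), 0) \<in> perturbed_dual"
      by (rule perturbed_dualI[OF v, where \<gamma> = 0 and \<xi> = 0]) (auto simp: \<phi>0 \<phi>\<tau> \<phi>p \<phi>m)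
    from le[OF this] have "(\<integral>z. apply_bcontfun \<phi>0 z \<partial>\<mu>0) + (\<integral>z. apply_bcontfun \<phi>\<tau> z \<partial>\<mu>\<tau>) + (\<integral>z. apply_bcontfun \<phi>p z \<partial>\<mu>p) + (\<integral>z. apply_bcontfun \<phi>m z \<partial>\<mu>m) \<le> 0"
      by (simp add: split)
    moreover have "(\<integral>z. apply_bcontfun \<phi>0 z \<partial>\<mu>0) = (\<integral>z. - (\<lambda>(s, x). v (s, 0, x)) z \<partial>\<mu>0)"
      by (rule Bochner_Integration.integral_cong[OF refl]) (simp only: sp \<phi>0)
    moreover have "(\<integral>z. apply_bcontfun \<phi>\<tau> z \<partial>\<mu>\<tau>) = (\<integral>z. (\<lambda>(s, x). v (s, s, x)) z \<partial>\<mu>\<tau>)"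
      by (rule Bochner_Integration.integral_cong[OF refl]) (simp only: sp \<phi>\<tau>)
    moreover have "(\<integral>z. apply_bcontfun \<phi>p z \<partial>\<mu>p) = (\<integral>z. - aug_gen L v z \<partial>\<mu>p)"
      by (rule Bochner_Integration.integral_cong[OF refl]) (simp only: sp \<phi>p)
    moreover have "(\<integral>z. apply_bcontfun \<phi>m z \<partial>\<mu>m) = (\<integral>z. - aug_gen L v z \<partial>\<mu>m)"
      by (rule Bochner_Integration.integral_cong[OF refl]) (simp only: sp \<phi>m)
    ultimately show ?thesis by (simp add: Bochner_Integration.integral_minus)
  qed
  have "(\<integral>(s, x). v (s, s, x) \<partial>\<mu>\<tau>) = (\<integral>(s, x). v (s, 0, x) \<partial>\<mu>0) +
      ((\<integral>z. aug_gen L v z \<partial>\<mu>m) + (\<integral>z. aug_gen L v z \<partial>\<mu>p))" if v: "v \<in> Dom" for v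
  proof (rule antisym[OF ineq[OF v]])
    have neg: "(\<lambda>z. - v z) \<in> Dom" "\<And>z. z \<in> D \<Longrightarrow> aug_gen L (\<lambda>z. - v z) z = - aug_gen L v z"
      using aug_dom_combination[OF v v, where a = "-1" and b = 0] by auto
    have "(\<integral>z. aug_gen L (\<lambda>z. - v z) z \<partial>\<mu>m) = (\<integral>z. - aug_gen L v z \<partial>\<mu>m)"
      using supports_subset by (intro Bochner_Integration.integral_cong[OF refl] neg(2)) (auto simp: sp)
    moreover have "(\<integral>z. aug_gen L (\<lambda>z. - v z) z \<partial>\<mu>p) = (\<integral>z. - aug_gen L v z \<partial>\<mu>p)"
      using supports_subset by (intro Bochner_Integration.integral_cong[OF refl] neg(2)) (auto simp: sp)
    ultimately show "(\<integral>(s, x). v (s, 0, x) \<partial>\<mu>0) + ((\<integral>z. aug_gen L v z \<partial>\<mu>m) + (\<integral>z. aug_gen L v z \<partial>\<mu>p))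
        \<le> (\<integral>(s, x). v (s, s, x) \<partial>\<mu>\<tau>)"
      using ineq[OF neg(1)] by (simp add: case_prod_unfold)
  qed
  then have "(\<mu>0, \<mu>\<tau>, \<mu>p, \<mu>m) \<in> measure_feasible tm T h X X0 C L"
    using \<mu>0(1) \<mu>\<tau>(1) \<mu>p(1) \<mu>m(1) mass0 massp by (simp add: measure_feasible_def)
  then show thesis using \<mu>p(2) by (rule that)
qed

text \<open>
  The case distinction asks whether the cone of the function program has a direction of recession
  along which the cost decreases. If it has, both values are \<open>-\<infinity>\<close>; if not, the multiplier at
  \<open>p / h\<close> provides the optimal measures.
\<close>

theorem strong_duality:
  assumes p: "continuous_on X p"
  shows "p_star tm T h X X0 p C L = d_star tm T h X X0 p C L \<and>
    (measure_feasible tm T h X X0 C L \<noteq> {} \<longrightarrow>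
      (\<exists>m \<in> measure_feasible tm T h X X0 C L.
         ereal (measure_objective h p m) = p_star tm T h X X0 p C L))"
proof -
  let ?F = "measure_feasible tm T h X X0 C L"
  let ?p = "p_star tm T h X X0 p C L" and ?d = "d_star tm T h X X0 p C L"
  have weak: "?p \<le> ?d"
    unfolding p_star_def d_star_def
    by (intro SUP_least INF_greatest) (use weak_duality[OF p] in \<open>auto simp: ereal_less_eq\<close>)
  have upper: "ereal (measure_objective h p m) \<le> ?p" if "m \<in> ?F" for m
    unfolding p_star_def using that by (rule SUP_upper)
  have "continuous_on Kp (\<lambda>(s, t, x). p x / h)"
    unfolding case_prod_unfold
    by (intro continuous_intros continuous_on_compose2[OF p])
       (use h in \<open>auto intro!: continuous_intros simp: supp_plus_def\<close>)
  from bounded_continuous_extension[OF compact_supports(3) this]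
  obtain \<pi> :: "(real \<times> real \<times> 'a) \<Rightarrow>\<^sub>C real" where "\<And>z. z \<in> Kp \<Longrightarrow> apply_bcontfun \<pi> z = (\<lambda>(s, t, x). p x / h) z" by blast
  then have \<pi>: "\<And>s t x. (s, t, x) \<in> Kp \<Longrightarrow> apply_bcontfun \<pi> (s, t, x) = p x / h" by auto
  have d: "?d = (INF r\<in>{r. ((0, 0, \<pi>, 0), r) \<in> perturbed_dual}. ereal r)"
    by (rule d_star_eq_INF) (rule \<pi>)
  show ?thesis
  proof (cases "\<exists>r<0. (0, r) \<in> perturbed_dual")
    case True
    then obtain r where r: "r < 0" "(0, r) \<in> perturbed_dual" by blast
    obtain r0 where r0: "((0, 0, \<pi>, 0), r0) \<in> perturbed_dual" using perturbed_dual_total by blast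
    have ray: "?d \<le> ereal (r0 + n * r)" if "0 \<le> n" for n
      unfolding d using perturbed_dual_comb[OF r0 r(2), of 1 n] that by (intro INF_lower) simp
    have "?d \<le> ereal B" for B
    proof -
      \<comment> \<open>Moving this far along the ray brings the cost below \<open>B\<close>.\<close>
      define n where "n = max 0 ((B - r0) / r)"
      have "(B - r0) / r \<le> n" "0 \<le> n" by (auto simp: n_def)
      then have "r0 + n * r \<le> B" using r(1) by (simp add: neg_divide_le_eq)
      then show ?thesis using ray[OF \<open>0 \<le> n\<close>] by (meson ereal_less_eq(3) order_trans)
    qed
    then have d_inf: "?d = - \<infinity>" by (rule ereal_bot)
    then have p_inf: "?p = - \<infinity>" using weak by simp
    have "?F = {}"
    proof (rule ccontr)
      assume "?F \<noteq> {}"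
      then obtain m where "m \<in> ?F" by blast
      from upper[OF this] p_inf show False by simp
    qed
    with d_inf p_inf show ?thesis by simp
  next
    case False
    have add: "(e + e', r + r') \<in> perturbed_dual" if "(e, r) \<in> perturbed_dual" "(e', r') \<in> perturbed_dual" for e e' r r'
      using perturbed_dual_comb[OF that, of 1 1] by simp
    have scale: "(a *\<^sub>R e, a * r) \<in> perturbed_dual" if "0 \<le> a" "(e, r) \<in> perturbed_dual" for a e r
      using perturbed_dual_comb[OF that(2) that(2) that(1), of 0] by simp
    have proper: "0 \<le> r" if "(0, r) \<in> perturbed_dual" for r
      using False that by (auto simp: not_less[symmetric])
    have "\<exists>\<Lambda>. linear \<Lambda> \<and> (\<forall>e r. (e, r) \<in> perturbed_dual \<longrightarrow> \<Lambda> e \<le> r) \<and>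
        \<Lambda> (0, 0, \<pi>, 0) = Inf {r. ((0, 0, \<pi>, 0), r) \<in> perturbed_dual}"
      by (rule cone_value_functional) (erule (1) add, erule (1) scale, rule perturbed_dual_total, erule proper)
    then obtain \<Lambda> where \<Lambda>: "linear \<Lambda>" "\<And>e r. (e, r) \<in> perturbed_dual \<Longrightarrow> \<Lambda> e \<le> r"
      "\<Lambda> (0, 0, \<pi>, 0) = Inf {r. ((0, 0, \<pi>, 0), r) \<in> perturbed_dual}"
      by blast
    have bdd: "bdd_below {r. ((0, 0, \<pi>, 0), r) \<in> perturbed_dual}"
      by (rule cone_fibre_bdd_below) (erule (1) add, rule perturbed_dual_total, erule proper)
    obtain \<mu>0 \<mu>\<tau> \<mu>p \<mu>m where m: "(\<mu>0, \<mu>\<tau>, \<mu>p, \<mu>m) \<in> ?F"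
      and \<Lambda>p: "\<And>\<phi> :: (real \<times> real \<times> 'a) \<Rightarrow>\<^sub>C real. \<Lambda> (0, 0, \<phi>, 0) = (\<integral>z. apply_bcontfun \<phi> z \<partial>\<mu>p)"
      using measures_of_functional[OF \<Lambda>(1,2)] by blast
    have "\<mu>p \<in> radon_measures Kp" using m by (simp add: measure_feasible_def)
    then have "(\<integral>z. apply_bcontfun \<pi> z \<partial>\<mu>p) = (\<integral>z. (\<lambda>(s, t, x). p x) z / h \<partial>\<mu>p)"
      by (intro Bochner_Integration.integral_cong refl) (auto simp: radon_measures_space \<pi>)
    then have "measure_objective h p (\<mu>0, \<mu>\<tau>, \<mu>p, \<mu>m) = \<Lambda> (0, 0, \<pi>, 0)"
      by (simp add: measure_objective_def \<Lambda>p)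
    moreover have "ereal (\<Lambda> (0, 0, \<pi>, 0)) = ?d"
      unfolding \<Lambda>(3) d using bdd perturbed_dual_total by (intro ereal_Inf') auto
    ultimately have opt: "ereal (measure_objective h p (\<mu>0, \<mu>\<tau>, \<mu>p, \<mu>m)) = ?d" by simp
    with upper[OF m] weak have "?p = ?d" by (intro antisym) auto
    with m opt show ?thesis by auto
  qed
qed

end

text \<open>
  The identity \<open>L t = 1\<close> is part of being a generator; compactness and \<open>L 1 = 0\<close> come from the
  assumptions on the sets and on the domain.
\<close>

theorem theorem4p5:
  fixes T h :: real
    and tm :: time_model
    and X X0 :: "(real ^ 'n) set"
    and p :: "(real ^ 'n) \<Rightarrow> real"
    and P :: "real \<Rightarrow> (real ^ 'n) \<Rightarrow> 'w measure"
    and Y :: "real \<Rightarrow> 'w \<Rightarrow> (real ^ 'n)"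
    and C :: "(real \<times> (real ^ 'n) \<Rightarrow> real) set"
    and L :: "(real \<times> (real ^ 'n) \<Rightarrow> real) \<Rightarrow> real \<times> (real ^ 'n) \<Rightarrow> real"
  assumes "0 < T" and "0 < h" and "h \<le> T"
    and "valid_time tm T"
    and "X0 \<subseteq> X"
    and "is_generator tm T X P Y C L"
    and "assumption_A1 X X0"
    and "assumption_A2 X p"
    and "assumption_A3 tm T X P Y"
    and "assumption_A4 T X C L"
    and "assumption_A5 T X C"
    and "assumption_A6 T X C L"
  shows "p_star tm T h X X0 p C L = d_star tm T h X X0 p C L \<and>
    (measure_feasible tm T h X X0 C L \<noteq> {} \<longrightarrow>
      (\<exists>m \<in> measure_feasible tm T h X X0 C L.
         ereal (measure_objective h p m) = p_star tm T h X X0 p C L))"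
proof -
  interpret augmented_generator tm T h X X0 C L
    using assms by unfold_locales (auto simp: is_generator_def assumption_A1_def assumption_A4_def)
  show ?thesis
    using \<open>assumption_A2 X p\<close> by (intro strong_duality) (simp add: assumption_A2_def)
qed

end
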